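(* As formal power series in $q$ (equivalently, for $|q|<1$), $$\sum_{m,n\ge 0}\frac{(-1)^n q^{2\binom{m+1}{2}+2\binom{n+1}{2}+2mn-m-n}}{(q;q)_m\,(q^2;q^2)_n}=\frac{1}{(q^2,q^4,q^{10},q^{12};q^{14})_\infty},$$ $$\sum_{m,n\ge 0}\frac{(-1)^n q^{2\binom{m+1}{2}+2\binom{n+1}{2}+2mn+n}}{(q;q)_m\,(q^2;q^2)_n}=\frac{1}{(q^2,q^6,q^{8},q^{12};q^{14})_\infty},$$ $$\sum_{m,n\ge 0}\frac{(-1)^n q^{2\binom{m+1}{2}+2\binom{n+1}{2}+2mn+m+n}}{(q;q)_m\,(q^2;q^2)_n}=\frac{1}{(q^4,q^6,q^{8},q^{10};q^{14})_\infty}.$$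
   Context: For $k\ge 0$, $(a;q)_k=\prod_{j=1}^{k}(1-aq^{j-1})$, $(a;q)_\infty=\prod_{j\ge 1}(1-aq^{j-1})$, and $(a_1,\dots,a_r;q)_\infty=(a_1;q)_\infty\cdots(a_r;q)_\infty$. *)

theory Defs
  imports "HOL-Analysis.Analysis" "HOL-Computational_Algebra.Formal_Power_Series"
begin

definition qpoch :: "'a::comm_ring_1 \<Rightarrow> 'a \<Rightarrow> nat \<Rightarrow> 'a" where
  "qpoch a q k = (\<Prod>j=1..k. 1 - a * q ^ (j - 1))"

text \<open>The infinite product is indexed from 0, so its j-th factor is the
  (j+1)-st factor of \<^const>\<open>qpoch\<close>. On formal power series the limit is taken in the
  library's metric, i.e. coefficientwise stabilisation.\<close>

definition qpoch_inf :: "'a::{t2_space, comm_ring_1} \<Rightarrow> 'a \<Rightarrow> 'a" where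
  "qpoch_inf a q = (\<Prod>j. 1 - a * q ^ j)"

definition qpoch_inf_list :: "'a::{t2_space, comm_ring_1} list \<Rightarrow> 'a \<Rightarrow> 'a" where
  "qpoch_inf_list as q = (\<Prod>a\<leftarrow>as. qpoch_inf a q)"

end

theory Submission
  imports Defs "HOL-Complex_Analysis.Complex_Analysis"
begin

text \<open>
  Put \<open>p = q\<^sup>2\<close>. For fixed \<open>m + n = N\<close> the inner sum of the first and third identity is the coefficient of
  \<open>z\<^sup>N\<close> in \<open>1 / ((z; q)\<^sub>\<infinity> (-z; p)\<^sub>\<infinity>) = 1 / ((z\<^sup>2; p\<^sup>2)\<^sub>\<infinity> (q z; p)\<^sub>\<infinity>)\<close>, and similarly for the second one with
  \<open>-q z\<close> in place of \<open>-z\<close>. Expanding the right-hand side gives a double sum over \<open>i, j\<close> with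
  \<open>N = 2 i + j\<close> in which only powers of \<open>p\<close> occur and the sum over \<open>j\<close> is Euler's, so that what remains is
  \<open>(-p; p)\<^sub>\<infinity>\<close> times one of the three Rogers--Selberg sums modulo 7 in the variable \<open>p\<close>.

  The Rogers--Selberg identities follow from Bailey's lemma and Jacobi's triple product. The required
  Bailey pairs come from the sums
  \<open>\<Sum>\<^sub>r (-1)\<^sup>r q\<^bsup>r(3r+1)/2 + d r\<^esup> / ((q\<^sup>2; q\<^sup>2)\<^bsub>a-r\<^esub> (q\<^sup>2; q\<^sup>2)\<^bsub>b+r\<^esub>)\<close>
  over all integers \<open>r\<close>: lowering \<open>a\<close> or \<open>b\<close>, shifting \<open>r\<close> and reflecting \<open>r\<close> give enough linear relations
  between them to evaluate the ones needed by induction.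

  The formal identities follow from the analytic ones: on \<open>\<bar>q\<bar> < 1/2\<close> both sides are uniform limits of
  functions whose Taylor coefficients stabilise to those of the formal sum and product.
\<close>

section \<open>q-Pochhammer symbols\<close>

lemma qpoch_0 [simp]: "qpoch a q 0 = 1"
  by (simp add: qpoch_def)

lemma qpoch_Suc: "qpoch a q (Suc n) = qpoch a q n * (1 - a * q ^ n)"
  by (simp add: qpoch_def)

lemma qpoch_conv_prod_lessThan: "qpoch a q n = (\<Prod>j<n. 1 - a * q ^ j)"
  by (induction n) (simp_all add: qpoch_Suc)

lemma one_minus_mult_power_nonzero:
  fixes a q :: complex
  assumes "norm a < 1" "norm q < 1"
  shows "1 - a * q ^ n \<noteq> 0"
proof
  assume "1 - a * q ^ n = 0"
  hence "norm (a * q ^ n) = 1" by (metis eq_iff_diff_eq_0 norm_one)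
  moreover have "norm (a * q ^ n) \<le> norm a * 1"
    unfolding norm_mult norm_power using assms
    by (intro mult_left_mono power_le_one) auto
  ultimately show False using assms by simp
qed

lemma qpoch_nonzero:
  fixes a q :: complex
  assumes "norm a < 1" "norm q < 1"
  shows "qpoch a q n \<noteq> 0"
  unfolding qpoch_def using one_minus_mult_power_nonzero[OF assms] by simp

lemma convergent_prod_qpoch:
  fixes a q :: complex
  assumes "norm q < 1"
  shows "convergent_prod (\<lambda>j. 1 - a * q ^ j)"
proof (rule abs_convergent_prod_imp_convergent_prod, rule summable_imp_abs_convergent_prod)
  show "summable (\<lambda>i. norm (1 - a * q ^ i - 1))"
    using assms by (simp add: norm_mult norm_power summable_mult)
qed

lemma qpoch_tendsto_qpoch_inf:
  fixes a q :: complex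
  assumes "norm q < 1"
  shows "(\<lambda>n. qpoch a q n) \<longlonglongrightarrow> qpoch_inf a q"
  using convergent_prod_LIMSEQ[OF convergent_prod_qpoch[OF assms, of a]]
  unfolding qpoch_conv_prod_lessThan qpoch_inf_def
  by (simp add: LIMSEQ_lessThan_iff_atMost)

lemma qpoch_inf_nonzero:
  fixes a q :: complex
  assumes "norm a < 1" "norm q < 1"
  shows "qpoch_inf a q \<noteq> 0"
  unfolding qpoch_inf_def
  by (intro prodinf_nonzero convergent_prod_qpoch one_minus_mult_power_nonzero assms)

lemma qpoch_add: "qpoch a q (m + n) = qpoch a q m * qpoch (a * q ^ m) q n"
  by (induction n) (simp_all add: qpoch_Suc power_add mult_ac)

lemma qpoch_inf_split:
  fixes a q :: complex
  assumes "norm q < 1"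
  shows "qpoch_inf a q = qpoch a q m * qpoch_inf (a * q ^ m) q"
proof (rule LIMSEQ_unique)
  show "(\<lambda>n. qpoch a q (m + n)) \<longlonglongrightarrow> qpoch_inf a q"
    using LIMSEQ_ignore_initial_segment[OF qpoch_tendsto_qpoch_inf[OF assms], of a m]
    by (simp add: add.commute)
  show "(\<lambda>n. qpoch a q (m + n)) \<longlonglongrightarrow> qpoch a q m * qpoch_inf (a * q ^ m) q"
    unfolding qpoch_add by (intro tendsto_intros qpoch_tendsto_qpoch_inf assms)
qed

text \<open>Sorts the factors \<open>1 - a * q ^ j\<close> by the residue of j modulo k. With k = 7,
  the limit version later splits (p; p)_infinity into its residue classes.\<close>

lemma qpoch_dissect: "qpoch a q (k * n) = (\<Prod>i<k. qpoch (a * q ^ i) (q ^ k) n)"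
proof (induction n)
  case (Suc n)
  have "qpoch a q (k * Suc n) = qpoch a q (k * n + k)" by (simp add: add.commute)
  also have "\<dots> = (\<Prod>i<k. qpoch (a * q ^ i) (q ^ k) n) * qpoch (a * q ^ (k * n)) q k"
    by (simp only: qpoch_add Suc)
  also have "\<dots> = (\<Prod>i<k. qpoch (a * q ^ i) (q ^ k) (Suc n))"
    by (simp add: qpoch_Suc prod.distrib qpoch_conv_prod_lessThan mult_ac power_mult)
  finally show ?case .
qed simp

lemma qpoch_inf_dissect:
  fixes a q :: complex
  assumes "norm q < 1" "k > 0"
  shows "qpoch_inf a q = (\<Prod>i<k. qpoch_inf (a * q ^ i) (q ^ k))"
proof (rule LIMSEQ_unique)
  have *: "filterlim (\<lambda>n. k * n) sequentially sequentially"
    using assms by (simp add: mult_nat_left_at_top)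
  show "(\<lambda>n. qpoch a q (k * n)) \<longlonglongrightarrow> qpoch_inf a q"
    using filterlim_compose[OF qpoch_tendsto_qpoch_inf[OF assms(1)] *] .
  have "norm (q ^ k) < 1"
    using assms by (simp add: norm_power power_less_one_iff)
  thus "(\<lambda>n. qpoch a q (k * n)) \<longlonglongrightarrow> (\<Prod>i<k. qpoch_inf (a * q ^ i) (q ^ k))"
    unfolding qpoch_dissect by (intro tendsto_prod qpoch_tendsto_qpoch_inf)
qed

lemma qpoch_neg_mult: "qpoch (-a) q n * qpoch a q n = qpoch (a ^ 2) (q ^ 2) n"
  by (induction n) (simp_all add: qpoch_Suc power2_eq_square algebra_simps power_mult_distrib)

lemma qpoch_inf_neg_mult:
  fixes a q :: complex
  assumes "norm q < 1"
  shows "qpoch_inf (-a) q * qpoch_inf a q = qpoch_inf (a ^ 2) (q ^ 2)"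
proof (rule LIMSEQ_unique)
  show "(\<lambda>n. qpoch (-a) q n * qpoch a q n) \<longlonglongrightarrow> qpoch_inf (-a) q * qpoch_inf a q"
    by (intro tendsto_intros qpoch_tendsto_qpoch_inf assms)
  have "norm (q ^ 2) < 1" using assms by (simp add: norm_power power_less_one_iff)
  thus "(\<lambda>n. qpoch (-a) q n * qpoch a q n) \<longlonglongrightarrow> qpoch_inf (a ^ 2) (q ^ 2)"
    unfolding qpoch_neg_mult by (intro qpoch_tendsto_qpoch_inf)
qed

text \<open>Extending \<open>1 / (q; q)\<^sub>k\<close> by zero to negative \<open>k\<close> keeps its recurrence valid for all integers,
  so that sums over \<open>\<int>\<close> can be manipulated without boundary terms.\<close>
definition rpoch :: "complex \<Rightarrow> int \<Rightarrow> complex" where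
  "rpoch q k = (if k < 0 then 0 else 1 / qpoch q q (nat k))"

lemma rpoch_of_nat [simp]: "rpoch q (int n) = 1 / qpoch q q n"
  by (simp add: rpoch_def)

lemma rpoch_0 [simp]: "rpoch q 0 = 1"
  by (simp add: rpoch_def)

lemma rpoch_neg: "k < 0 \<Longrightarrow> rpoch q k = 0"
  by (simp add: rpoch_def)

lemma rpoch_rec:
  assumes "norm q < 1"
  shows "rpoch q (k - 1) = (1 - q powi k) * rpoch q k"
proof (cases "k > 0")
  case True
  then obtain n where n: "k = int (Suc n)" by (metis Suc_pred' zero_less_imp_eq_int)
  have "qpoch q q (Suc n) \<noteq> 0" using assms by (simp add: qpoch_nonzero)
  thus ?thesis unfolding n
    by (simp add: rpoch_def nat_add_distrib qpoch_Suc field_simps power_int_add_1' power_int_def)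
next
  case False
  \<comment> \<open>At k = 0 the factor \<open>1 - q powi 0\<close> is zero, which matches the value
    0 at index -1; for negative k both sides vanish by convention.\<close>
  thus ?thesis by (cases "k = 0") (auto simp: rpoch_def)
qed

text \<open>The values 1/(q; q)_n converge to a finite limit because the infinite product is
  nonzero. The bound K supplies the majorants in the limit interchanges below.\<close>

lemma rpoch_bounded:
  assumes "norm q < 1"
  obtains K where "K > 0" "\<And>k. norm (rpoch q k) \<le> K"
proof -
  have "(\<lambda>n. 1 / qpoch q q n) \<longlonglongrightarrow> 1 / qpoch_inf q q"
    using assms by (intro tendsto_intros qpoch_tendsto_qpoch_inf qpoch_inf_nonzero)
  hence "Bseq (\<lambda>n. 1 / qpoch q q n)"
    using convergent_imp_Bseq convergentI by blast
  then obtain K where K: "K > 0" "\<And>n. norm (1 / qpoch q q n) \<le> K"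
    unfolding Bseq_def by blast
  show ?thesis
    by (rule that[OF K(1)]) (use K in \<open>auto simp: rpoch_def\<close>)
qed

lemma rpoch_tendsto:
  assumes "norm q < 1"
  shows "(\<lambda>n. rpoch q (int n + k)) \<longlonglongrightarrow> 1 / qpoch_inf q q"
proof -
  have "(\<lambda>n. rpoch q (int n)) \<longlonglongrightarrow> 1 / qpoch_inf q q"
    unfolding rpoch_of_nat using assms
    by (intro tendsto_intros qpoch_tendsto_qpoch_inf qpoch_inf_nonzero)
  moreover have "filterlim (\<lambda>n. nat (int n + k)) sequentially sequentially"
    unfolding filterlim_at_top
  proof
    fix Z :: nat
    show "\<forall>\<^sub>F n in sequentially. Z \<le> nat (int n + k)"
      using eventually_ge_at_top[of "Z + nat \<bar>k\<bar>"] by eventually_elim linarith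
  qed
  ultimately have "(\<lambda>n. rpoch q (int (nat (int n + k)))) \<longlonglongrightarrow> 1 / qpoch_inf q q"
    by (rule filterlim_compose)
  moreover have "\<forall>\<^sub>F n in sequentially. rpoch q (int (nat (int n + k))) = rpoch q (int n + k)"
    using eventually_ge_at_top[of "nat \<bar>k\<bar>"] by eventually_elim (simp del: rpoch_of_nat)
  ultimately show ?thesis by (rule Lim_transform_eventually)
qed

section \<open>Dominated convergence for unordered sums\<close>

lemma summable_on_dominated:
  fixes f :: "'a \<Rightarrow> complex"
  assumes "M summable_on A" "\<And>x. x \<in> A \<Longrightarrow> norm (f x) \<le> M x"
  shows "f summable_on A"
  by (rule abs_summable_summable[OF Infinite_Sum.abs_summable_on_comparison_test'[OF assms]])

text \<open>Tannery's theorem: by the Weierstrass M-test the finite partial sums converge uniformly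
  in n, so the two limits may be swapped.\<close>

lemma infsum_tendsto_dominated:
  fixes f :: "'a \<Rightarrow> nat \<Rightarrow> complex"
  assumes bound: "\<And>i n. norm (f i n) \<le> M i" and M: "M summable_on UNIV"
    and lim: "\<And>i. f i \<longlonglongrightarrow> g i"
  shows "(\<lambda>n. \<Sum>\<^sub>\<infinity>i. f i n) \<longlonglongrightarrow> (\<Sum>\<^sub>\<infinity>i. g i)"
proof (rule swap_uniform_limit'[where S = UNIV])
  show "uniform_limit UNIV (\<lambda>X n. \<Sum>i\<in>X. f i n) (\<lambda>n. \<Sum>\<^sub>\<infinity>i. f i n) (finite_subsets_at_top UNIV)"
    by (rule Weierstrass_m_test_general[OF bound M])
  show "\<forall>\<^sub>F X in finite_subsets_at_top UNIV. ((\<lambda>n. \<Sum>i\<in>X. f i n) \<longlonglongrightarrow> (\<Sum>i\<in>X. g i))"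
    by (intro always_eventually allI tendsto_sum lim)
  have "norm (g i) \<le> M i" for i
    by (rule tendsto_upperbound[OF tendsto_norm[OF lim]]) (auto simp: bound)
  hence "g summable_on UNIV"
    by (rule summable_on_dominated[OF M])
  thus "((\<lambda>X. \<Sum>i\<in>X. g i) \<longlongrightarrow> (\<Sum>\<^sub>\<infinity>i. g i)) (finite_subsets_at_top UNIV)"
    by (rule infsum_tendsto)
qed auto

lemma summable_on_int_power_abs:
  fixes r :: real
  assumes "0 \<le> r" "r < 1"
  shows "(\<lambda>k::int. r ^ nat \<bar>k\<bar>) summable_on UNIV"
proof -
  have s: "(\<lambda>n::nat. r ^ n) summable_on UNIV"
    using assms by (intro summable_nonneg_imp_summable_on) auto
  have "(\<lambda>k::int. r ^ nat \<bar>k\<bar>) summable_on range int"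
    by (subst summable_on_reindex) (use s in \<open>auto simp: o_def\<close>)
  moreover have "(\<lambda>k::int. r ^ nat \<bar>k\<bar>) summable_on range (\<lambda>n. - int n - 1)"
  proof (subst summable_on_reindex)
    have "(\<lambda>n. r * r ^ n) summable_on UNIV" by (intro summable_on_cmult_right s)
    moreover have "nat \<bar>- int n - 1\<bar> = Suc n" for n by linarith
    ultimately show "(\<lambda>k::int. r ^ nat \<bar>k\<bar>) \<circ> (\<lambda>n. - int n - 1) summable_on UNIV"
      by (simp add: o_def)
  qed (auto simp: inj_on_def)
  ultimately have "(\<lambda>k::int. r ^ nat \<bar>k\<bar>) summable_on (range int \<union> range (\<lambda>n. - int n - 1))"
    by (intro summable_on_Un_disjoint) auto
  also have "range int \<union> range (\<lambda>n. - int n - 1) = UNIV"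
  proof -
    have "k \<in> range int \<union> range (\<lambda>n. - int n - 1)" for k
    proof (cases "k \<ge> 0")
      case True thus ?thesis by (metis UnI1 rangeI int_nat_eq)
    next
      case False
      hence "k = - int (nat (- k - 1)) - 1" by simp
      thus ?thesis by blast
    qed
    thus ?thesis by blast
  qed
  finally show ?thesis .
qed

section \<open>Finite Bailey pairs and the finite triple product\<close>

text \<open>For \<open>a = b = n\<close> this is the beta-side of a Bailey pair relative to 1, and
  for \<open>a = n\<close>, \<open>b = n + 1\<close> relative to x up to the factor 1 - x, with the
  alpha-side unfolded over all integers. Keeping a and b independent allows each to be lowered
  separately.\<close>

definition bailey_sum :: "complex \<Rightarrow> (int \<Rightarrow> complex) \<Rightarrow> int \<Rightarrow> int \<Rightarrow> complex" where
  "bailey_sum x w a b = (\<Sum>\<^sub>\<infinity>r. w r * rpoch x (a - r) * rpoch x (b + r))"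

lemma bailey_sum_summable: "(\<lambda>r. w r * rpoch x (a - r) * rpoch x (b + r)) summable_on UNIV"
proof (rule finite_nonzero_values_imp_summable_on)
  have "{r \<in> UNIV. w r * rpoch x (a - r) * rpoch x (b + r) \<noteq> 0} \<subseteq> {- b..a}"
    by (auto intro: ccontr simp: rpoch_def)
  thus "finite {r \<in> UNIV. w r * rpoch x (a - r) * rpoch x (b + r) \<noteq> 0}"
    by (rule finite_subset) simp
qed

lemma bailey_sum_cmult: "bailey_sum x (\<lambda>r. c * w r) a b = c * bailey_sum x w a b"
  unfolding bailey_sum_def by (simp add: mult.assoc infsum_cmult_right')

lemma bailey_sum_shift: "bailey_sum x w a b = bailey_sum x (\<lambda>r. w (r + 1)) (a - 1) (b + 1)"
  unfolding bailey_sum_def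
  by (rule infsum_reindex_bij_witness[of _ "\<lambda>r. r + 1" "\<lambda>r. r - 1"]) (auto simp: algebra_simps)

lemma bailey_sum_reflect: "bailey_sum x w a b = bailey_sum x (\<lambda>r. w (- r)) b a"
  unfolding bailey_sum_def
  by (rule infsum_reindex_bij_witness[of _ uminus uminus]) (auto simp: algebra_simps)

lemma infsum_diff_cmult:
  fixes f g :: "'a \<Rightarrow> complex"
  assumes "f summable_on A" "g summable_on A"
  shows "(\<Sum>\<^sub>\<infinity>r\<in>A. f r - c * g r) = infsum f A - c * infsum g A"
proof -
  have "((\<lambda>r. f r + (-c) * g r) has_sum (infsum f A + (-c) * infsum g A)) A"
    by (intro has_sum_add has_sum_cmult_right has_sum_infsum assms)
  thus ?thesis by (simp add: infsumI)
qed

text \<open>\<open>rpoch_rec\<close> is applied to the factor \<open>rpoch x (a - r)\<close>. Its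
  coefficient \<open>x powi (a - r)\<close> splits into a constant and a part that is absorbed into
  the weight.\<close>

lemma bailey_sum_rec_left:
  assumes "norm x < 1" "x \<noteq> 0"
  shows "bailey_sum x w (a - 1) b =
    bailey_sum x w a b - x powi a * bailey_sum x (\<lambda>r. w r * x powi (- r)) a b"
proof -
  have "rpoch x (a - 1 - r) = rpoch x (a - r) - x powi a * x powi (- r) * rpoch x (a - r)" for r
    using rpoch_rec[OF assms(1), of "a - r"] assms(2)
    by (simp add: algebra_simps power_int_diff power_int_minus field_simps)
  hence "w r * rpoch x (a - 1 - r) * rpoch x (b + r) = w r * rpoch x (a - r) * rpoch x (b + r)
           - x powi a * (w r * x powi (- r) * rpoch x (a - r) * rpoch x (b + r))" for r
    by (simp only: ring_distribs mult_ac)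
  thus ?thesis
    unfolding bailey_sum_def by (simp only: infsum_diff_cmult[OF bailey_sum_summable bailey_sum_summable])
qed

lemma bailey_sum_rec_right:
  assumes "norm x < 1" "x \<noteq> 0"
  shows "bailey_sum x w a (b - 1) =
    bailey_sum x w a b - x powi b * bailey_sum x (\<lambda>r. w r * x powi r) a b"
  using bailey_sum_rec_left[OF assms, of "\<lambda>r. w (- r)" b a]
        bailey_sum_reflect[of x w] bailey_sum_reflect[of x "\<lambda>r. w r * x powi r"] by simp

section \<open>Bailey pairs with pentagonal weights\<close>

definition pentagonal :: "int \<Rightarrow> int" where
  "pentagonal r = r * (3 * r + 1) div 2"

lemma two_pentagonal: "2 * pentagonal r = r * (3 * r + 1)"
  unfolding pentagonal_def by (rule dvd_mult_div_cancel) auto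

lemma pentagonal_plus_1: "pentagonal (r + 1) = pentagonal r + 3 * r + 2"
  using two_pentagonal[of r] two_pentagonal[of "r + 1"] by (simp add: algebra_simps)

lemma pentagonal_minus: "pentagonal (- r) = pentagonal r - r"
  using two_pentagonal[of r] two_pentagonal[of "- r"] by (simp add: algebra_simps)

text \<open>The linear parameter d makes the family closed, up to constants, under the operations
  used on weights: multiplication by \<open>(q ^ 2) powi (k * r)\<close>, shifting r and reflecting
  r.\<close>

definition pent_weight :: "complex \<Rightarrow> int \<Rightarrow> int \<Rightarrow> complex" where
  "pent_weight q d r = (-1) powi r * q powi (pentagonal r + d * r)"

context
  fixes q :: complex
  assumes q: "norm q < 1" "q \<noteq> 0"
begin

lemma pent_weight_mult_power: "pent_weight q d r * (q ^ 2) powi (k * r) = pent_weight q (d + 2 * k) r"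
proof -
  have "(q ^ 2) powi (k * r) = q powi (2 * k * r)"
    by (metis power_int_mult power_int_numeral mult.assoc)
  thus ?thesis using q(2)
    by (simp add: pent_weight_def power_int_add algebra_simps)
qed

lemma pent_weight_shift: "pent_weight q d (r + 1) = - (q powi (d + 2)) * pent_weight q (d + 3) r"
proof -
  have "pentagonal (r + 1) + d * (r + 1) = (d + 2) + (pentagonal r + (d + 3) * r)"
    unfolding pentagonal_plus_1 by (simp add: algebra_simps)
  hence "q powi (pentagonal (r + 1) + d * (r + 1)) = q powi (d + 2) * q powi (pentagonal r + (d + 3) * r)"
    using q(2) by (simp only: power_int_add[of q "d + 2"] simp_thms)
  thus ?thesis by (simp add: pent_weight_def power_int_add)
qed

lemma pent_weight_reflect: "pent_weight q d (- r) = pent_weight q (- 1 - d) r"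
  by (simp add: pent_weight_def pentagonal_minus algebra_simps power_int_minus_one_minus)

private abbreviation "U a b d \<equiv> bailey_sum (q ^ 2) (pent_weight q d) a b"

private lemma Q: "norm (q ^ 2) < 1" "q ^ 2 \<noteq> 0"
  using q by (auto simp: norm_power power_less_one_iff)

private lemma Q_powi: "(q ^ 2) powi m = q powi (2 * m)"
  by (metis power_int_mult power_int_numeral)

private lemma U_left: "U (a - 1) b d = U a b d - (q ^ 2) powi a * U a b (d - 2)"
  using bailey_sum_rec_left[OF Q, of "pent_weight q d" a b] pent_weight_mult_power[of d _ "-1"] by simp

private lemma U_right: "U a (b - 1) d = U a b d - (q ^ 2) powi b * U a b (d + 2)"
  using bailey_sum_rec_right[OF Q, of "pent_weight q d" a b] pent_weight_mult_power[of d _ 1] by simp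

private lemma U_shift: "U a b d = - (q powi (d + 2)) * U (a - 1) (b + 1) (d + 3)"
  using bailey_sum_shift[of "q ^ 2" "pent_weight q d" a b]
  by (simp only: pent_weight_shift bailey_sum_cmult)

private lemma U_reflect: "U a b d = U b a (- 1 - d)"
  using bailey_sum_reflect[of "q ^ 2" "pent_weight q d" a b] by (simp only: pent_weight_reflect)

text \<open>Reflection turns d = 1 into d = -2 with the indices swapped, and a shift leads back with
  factor -1, so the sum equals its own negative.\<close>

private lemma U_vanish: "U n (n + 1) 1 = 0"
  using U_reflect[where a = n and b = "n + 1" and d = 1] U_shift[where a = "n + 1" and b = n and d = "-2"] by simp

text \<open>Lowering b at d = -1 produces the vanishing sum as its correction term; reflection then
  identifies d = -1 with d = 0 on the diagonal.\<close>

private lemma U_B: "U n (n + 1) (- 1) = U n n 0"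
  using U_right[where a = n and b = "n + 1" and d = "-1"] U_vanish[of n] U_reflect[where a = n and b = n and d = 0] by simp

text \<open>Lowering b at d = 0 brings in d = 2, which reflection followed by a shift makes
  proportional to d = 0 again.\<close>

private lemma U_C: "U n n 0 = (1 + q powi (2 * n + 1)) * U n (n + 1) 0"
proof -
  have "U n (n + 1) 2 = - (q powi (-1)) * U n (n + 1) 0"
    using U_reflect[where a = n and b = "n + 1" and d = 2] U_shift[where a = "n + 1" and b = n and d = "-3"] by simp
  moreover have "(q ^ 2) powi (n + 1) * q powi (-1) = q powi (2 * n + 1)"
    unfolding Q_powi using q(2) by (simp add: power_int_add power2_eq_square)
  ultimately show ?thesis
    using U_right[where a = n and b = "n + 1" and d = 0] by (simp add: algebra_simps)
qed

text \<open>Lowering a on the diagonal brings in d = -2. A shift moves that sum to d = 1 at the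
  indices \<open>m - 1\<close> and \<open>m + 1\<close>, where \<open>U_left\<close>,
  \<open>U_vanish\<close> and \<open>U_B\<close> evaluate it as a multiple of the diagonal
  sum.\<close>

private lemma U_step: "U n (n + 1) 0 = (1 - q powi (4 * n + 4)) * U (n + 1) (n + 1) 0"
proof -
  have "U (m - 1) (m + 1) 1 = - ((q ^ 2) powi m) * U m m 0" for m
    using U_left[where a = m and b = "m + 1" and d = 1] U_vanish[of m] U_B[of m] by simp
  hence "U m m (-2) = (q ^ 2) powi m * U m m 0" for m
    using U_shift[where a = m and b = m and d = "-2"] by simp
  moreover have "(q ^ 2) powi (n + 1) * (q ^ 2) powi (n + 1) = q powi (4 * n + 4)"
    using q(2) by (simp add: Q_powi flip: power_int_add)
  ultimately show ?thesis
    using U_left[where a = "n + 1" and b = "n + 1" and d = 0]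
    by (simp add: left_diff_distrib flip: mult.assoc)
qed

text \<open>\<open>U_C\<close> and \<open>U_step\<close> together give a first-order recurrence
  between consecutive diagonal sums, with initial value 1.\<close>

lemma bailey_pair_A:
  "bailey_sum (q ^ 2) (pent_weight q 0) (int n) (int n) = 1 / (qpoch (q ^ 2) (q ^ 2) n * qpoch (- q) q (2 * n))"
proof (induction n)
  case 0
  have "U 0 0 0 = (\<Sum>\<^sub>\<infinity>r\<in>{0::int}. 1)"
    unfolding bailey_sum_def
    by (rule infsum_cong_neutral) (auto simp: rpoch_def pent_weight_def pentagonal_def)
  thus ?case by simp
next
  case (Suc n)
  let ?a = "1 - q ^ (4 * n + 4)" and ?b = "1 + q ^ (2 * n + 1)"
  have nz: "1 - q ^ 2 * (q ^ 2) ^ n \<noteq> 0"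
    using one_minus_mult_power_nonzero[OF Q(1) Q(1)] .
  have nz': "1 + q * q ^ k \<noteq> 0" for k
    using one_minus_mult_power_nonzero[of "-q" q k] q by auto
  have e: "U (int (Suc n)) (int (Suc n)) 0 * ?a * ?b = U (int n) (int n) 0"
    using U_step[of "int n"] U_C[of "int n"]
    by (simp add: power_int_def nat_add_distrib nat_mult_distrib add.commute mult_ac)
  \<comment> \<open>1 - q^(4n+4) factors as (1 - q^(2n+2))(1 + q^(2n+2)). The first factor extends
    (q^2; q^2)_n; the second, together with \<open>?b\<close>, gives the two new factors of (-q;
    q)_(2n).\<close>
  have a: "?a = (1 - q ^ 2 * (q ^ 2) ^ n) * (1 + q * q ^ (2 * n + 1))"
    by (simp add: algebra_simps power_add power_mult eval_nat_numeral)
  have b: "?b = 1 + q * q ^ (2 * n)" by simp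
  have "?a * ?b \<noteq> 0"
    unfolding a b using nz nz' by (metis mult_eq_0_iff)
  hence "U (int (Suc n)) (int (Suc n)) 0 = U (int n) (int n) 0 / (?a * ?b)"
    using e by (simp only: eq_divide_eq mult.assoc if_False if_True simp_thms)
  thus ?case
    unfolding Suc a b by (simp add: qpoch_Suc mult_ac)
qed

lemma bailey_pair_B:
  "bailey_sum (q ^ 2) (pent_weight q (- 1)) (int n) (int n + 1) =
     1 / (qpoch (q ^ 2) (q ^ 2) n * qpoch (- q) q (2 * n))"
  using U_B bailey_pair_A by simp

lemma bailey_pair_C:
  "bailey_sum (q ^ 2) (pent_weight q 0) (int n) (int n + 1) =
     1 / (qpoch (q ^ 2) (q ^ 2) n * qpoch (- q) q (2 * n + 1))"
proof -
  have nz: "1 + q * q ^ (2 * n) \<noteq> 0"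
    using one_minus_mult_power_nonzero[of "-q" q "2 * n"] q by auto
  have "U (int n) (int n) 0 = (1 + q * q ^ (2 * n)) * U (int n) (int n + 1) 0"
    using U_C[of "int n"] by (simp add: power_int_def nat_add_distrib nat_mult_distrib)
  hence "U (int n) (int n + 1) 0 = U (int n) (int n) 0 / (1 + q * q ^ (2 * n))"
    using nz by simp
  thus ?thesis
    unfolding bailey_pair_A by (simp add: qpoch_Suc mult_ac)
qed

end

section \<open>The finite form of Jacobi's triple product\<close>

definition theta_weight :: "complex \<Rightarrow> complex \<Rightarrow> int \<Rightarrow> complex" where
  "theta_weight x z r = (-1) powi r * z powi r * x powi (r * (r - 1) div 2)"

lemma theta_exponent_plus_1: "(r + 1) * r div 2 = r * (r - 1) div 2 + (r :: int)"
proof -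
  have "(r + 1) * r = r * (r - 1) + r * 2" by (simp add: algebra_simps)
  thus ?thesis by (simp only: div_mult_self2[of 2])
qed

context
  fixes x z :: complex
  assumes x: "norm x < 1" "x \<noteq> 0" and z: "z \<noteq> 0"
begin

private abbreviation "V a b y \<equiv> bailey_sum x (theta_weight x y) a b"

text \<open>Stated for a general argument y because it is applied both at \<open>z / x\<close> and
  at z.\<close>

private lemma V_shift: "y \<noteq> 0 \<Longrightarrow> V a b y = - y * V (a - 1) (b + 1) (y * x)"
proof -
  assume y: "y \<noteq> 0"
  have "theta_weight x y (r + 1) = - y * theta_weight x (y * x) r" for r
    using x y theta_exponent_plus_1[of r]
    by (simp add: theta_weight_def power_int_add power_int_mult_distrib mult_ac)
  thus ?thesis
    using bailey_sum_shift[of x "theta_weight x y" a b] by (simp only: bailey_sum_cmult)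
qed

private lemma V_left: "V (a - 1) b z = V a b z + x powi (a - 1) * z * V (a - 1) (b + 1) z"
proof -
  have "theta_weight x z r * x powi (- r) = theta_weight x (z / x) r" for r
    by (simp add: theta_weight_def power_int_divide_distrib power_int_minus divide_simps)
  moreover have "V a b (z / x) = - (z / x) * V (a - 1) (b + 1) z"
    using V_shift[where y = "z / x" and a = a and b = b] x z by simp
  ultimately show ?thesis
    using bailey_sum_rec_left[OF x, of "theta_weight x z" a b] x by (simp add: power_int_diff)
qed

private lemma V_right: "V a (b - 1) z = V a b z + x powi b / z * V (a + 1) (b - 1) z"
proof -
  have "theta_weight x z r * x powi r = theta_weight x (z * x) r" for r
    by (simp add: theta_weight_def power_int_mult_distrib)
  moreover have "V a b (z * x) = - (1 / z) * V (a + 1) (b - 1) z"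
    using V_shift[where y = z and a = "a + 1" and b = "b - 1"] x z by simp
  ultimately show ?thesis
    using bailey_sum_rec_right[OF x, of "theta_weight x z" a b] x by simp
qed

text \<open>Eliminates \<open>V (a - 1) (b + 1) z\<close> between \<open>V_left\<close> and an
  instance of \<open>V_right\<close>, leaving a two-term recurrence in a.
  \<open>V_step_right\<close> does the same for b.\<close>

private lemma V_step_left: "(1 - x powi (a - 1) * z) * V (a - 1) b z = (1 - x powi (a + b)) * V a b z"
proof -
  have "V (a - 1) b z = V (a - 1) (b + 1) z + x powi (b + 1) / z * V a b z"
    using V_right[where a = "a - 1" and b = "b + 1"] by simp
  hence "z * V (a - 1) b z = z * V (a - 1) (b + 1) z + x powi (b + 1) * V a b z"
    using z by (simp add: field_simps)
  hence "x powi (a - 1) * z * V (a - 1) b z =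
      x powi (a - 1) * z * V (a - 1) (b + 1) z + x powi (a - 1) * x powi (b + 1) * V a b z"
    by (simp add: mult.assoc flip: distrib_left)
  moreover have "x powi (a - 1) * x powi (b + 1) = x powi (a + b)"
    using x by (simp flip: power_int_add)
  ultimately show ?thesis
    using V_left[where a = a and b = b] by (simp add: left_diff_distrib)
qed

private lemma V_step_right: "(1 - x powi b / z) * V a (b - 1) z = (1 - x powi (a + b)) * V a b z"
proof -
  have "V a (b - 1) z = V (a + 1) (b - 1) z + x powi a * z * V a b z"
    using V_left[where a = "a + 1" and b = "b - 1"] by simp
  hence "x powi b / z * V a (b - 1) z =
      x powi b / z * V (a + 1) (b - 1) z + x powi a * x powi b * V a b z"
    using z by (simp add: field_simps)
  moreover have "x powi a * x powi b = x powi (a + b)"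
    using x by (simp flip: power_int_add)
  ultimately show ?thesis
    using V_right[where a = a and b = b] by (simp add: left_diff_distrib)
qed

text \<open>Starting from the single term at a = b = 0, the two-term recurrences raise first a with
  b = 0 and then b; each step contributes one factor of the product.\<close>

lemma finite_jacobi_triple_product:
  "bailey_sum x (theta_weight x z) (int a) (int b) = qpoch z x a * qpoch (x / z) x b / qpoch x x (a + b)"
proof (induction b)
  have nz: "1 - x * x ^ k \<noteq> 0" for k
    using one_minus_mult_power_nonzero[OF x(1) x(1)] .
  {
    case 0
    show ?case
    proof (induction a)
      case 0
      have "V 0 0 z = (\<Sum>\<^sub>\<infinity>r\<in>{0::int}. 1)"
        unfolding bailey_sum_def
        by (rule infsum_cong_neutral) (auto simp: rpoch_def theta_weight_def)
      thus ?case by simp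
    next
      case (Suc a)
      have "(1 - z * x ^ a) * V (int a) 0 z = (1 - x * x ^ a) * V (int (Suc a)) 0 z"
        using V_step_left[where a = "int (Suc a)" and b = 0] x by (simp add: power_int_add mult_ac)
      hence "V (int (Suc a)) 0 z = (1 - z * x ^ a) / (1 - x * x ^ a) * V (int a) 0 z"
        using nz[of a] by (simp add: eq_divide_eq mult_ac)
      thus ?case using Suc by (simp add: qpoch_Suc mult_ac)
    qed
  next
    case (Suc b)
    have "x powi (int a + int (Suc b)) = x ^ (Suc (a + b))"
      using power_int_of_nat[of x "a + Suc b"] by (simp add: algebra_simps)
    moreover have "x powi int (Suc b) = x ^ Suc b" by (rule power_int_of_nat)
    ultimately have "(1 - x / z * x ^ b) * V (int a) (int b) z = (1 - x * x ^ (a + b)) * V (int a) (int (Suc b)) z"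
      using V_step_right[where b = "int (Suc b)" and a = "int a"] x by simp
    hence "V (int a) (int (Suc b)) z = (1 - x / z * x ^ b) / (1 - x * x ^ (a + b)) * V (int a) (int b) z"
      using nz[of "a + b"] by (simp add: eq_divide_eq mult_ac)
    thus ?case using Suc by (simp add: qpoch_Suc mult_ac)
  }
qed

end

section \<open>The triple product and Euler's sum\<close>

lemma norm_power_int_le:
  fixes x :: complex
  assumes "norm x < 1" "x \<noteq> 0" "m \<le> n"
  shows "norm (x powi n) \<le> norm x powi m"
  unfolding norm_power_int using assms by (intro power_int_decreasing) auto

lemma theta_weight_bound_nonneg:
  assumes "norm x < 1" "r \<ge> 0"
  shows "norm (theta_weight x z r) \<le> norm z ^ nat r"
proof -
  have "0 \<le> r * (r - 1) div 2"
    using assms(2) by (cases "r = 0") auto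
  hence "norm x powi (r * (r - 1) div 2) \<le> 1"
    using assms by (intro power_int_le_one) auto
  hence "norm z ^ nat r * norm x powi (r * (r - 1) div 2) \<le> norm z ^ nat r * 1"
    by (intro mult_left_mono) auto
  moreover have "norm z powi r = norm z ^ nat r"
    using assms(2) by (simp add: power_int_def)
  ultimately show ?thesis
    by (simp add: theta_weight_def norm_mult norm_power_int)
qed

lemma theta_weight_minus:
  assumes "x \<noteq> 0"
  shows "theta_weight x z (- r) = theta_weight x (x / z) r"
proof -
  have "(- r) * (- r - 1) div 2 = r * (r - 1) div 2 + r"
    using theta_exponent_plus_1[of r] by (simp add: algebra_simps)
  thus ?thesis using assms
    by (simp add: theta_weight_def power_int_add power_int_divide_distrib power_int_minus_one_minus
                  power_int_minus divide_simps)
qed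

text \<open>Reflection replaces z by x / z, so in the annulus |x| < |z| < 1 both halves of the
  bilateral series decay geometrically.\<close>

lemma theta_weight_bound:
  assumes x: "norm x < 1" "x \<noteq> 0" and z: "norm z < 1" "norm x < norm z"
  obtains \<rho> where "0 \<le> \<rho>" "\<rho> < 1" "\<And>r. norm (theta_weight x z r) \<le> \<rho> ^ nat \<bar>r\<bar>"
proof
  define \<rho> where "\<rho> = max (norm z) (norm (x / z))"
  show "0 \<le> \<rho>" "\<rho> < 1"
    using z by (auto simp: \<rho>_def norm_divide divide_simps le_max_iff_disj)
  show "norm (theta_weight x z r) \<le> \<rho> ^ nat \<bar>r\<bar>" for r
  proof (cases "r \<ge> 0")
    case True
    hence "norm (theta_weight x z r) \<le> norm z ^ nat \<bar>r\<bar>"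
      using theta_weight_bound_nonneg[OF x(1) True] by simp
    also have "\<dots> \<le> \<rho> ^ nat \<bar>r\<bar>" by (intro power_mono) (auto simp: \<rho>_def)
    finally show ?thesis .
  next
    case False
    hence "norm (theta_weight x z r) \<le> norm (x / z) ^ nat \<bar>r\<bar>"
      using theta_weight_bound_nonneg[OF x(1), of "-r" "x / z"] theta_weight_minus[OF x(2), of z "-r"]
      by simp
    also have "\<dots> \<le> \<rho> ^ nat \<bar>r\<bar>" by (intro power_mono) (auto simp: \<rho>_def)
    finally show ?thesis .
  qed
qed

text \<open>Both indices of the finite form tend to infinity together. The two \<open>rpoch\<close>
  factors contribute 1/P each and the denominator (x; x)_(2n) tends to P, so one factor P
  remains.\<close>

theorem jacobi_triple_product:
  assumes x: "norm x < 1" "x \<noteq> 0" and z: "norm z < 1" "norm x < norm z"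
  shows "(\<Sum>\<^sub>\<infinity>r. theta_weight x z r) = qpoch_inf z x * qpoch_inf (x / z) x * qpoch_inf x x"
proof -
  define P where "P = qpoch_inf x x"
  have P: "P \<noteq> 0" unfolding P_def using x by (intro qpoch_inf_nonzero)
  have z0: "z \<noteq> 0" using z x by auto
  obtain K where K: "K > 0" "\<And>k. norm (rpoch x k) \<le> K" using rpoch_bounded[OF x(1)] by blast
  obtain \<rho> where \<rho>: "0 \<le> \<rho>" "\<rho> < 1" "\<And>r. norm (theta_weight x z r) \<le> \<rho> ^ nat \<bar>r\<bar>"
    using theta_weight_bound[OF assms] by blast
  have "(\<lambda>n. bailey_sum x (theta_weight x z) (int n) (int n)) \<longlonglongrightarrow>
          (\<Sum>\<^sub>\<infinity>r. theta_weight x z r * (1 / P) * (1 / P))"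
    unfolding bailey_sum_def
  proof (rule infsum_tendsto_dominated)
    show "norm (theta_weight x z r * rpoch x (int n - r) * rpoch x (int n + r)) \<le> \<rho> ^ nat \<bar>r\<bar> * K * K" for r n
      unfolding norm_mult using \<rho> K by (intro mult_mono) (auto intro: less_imp_le mult_nonneg_nonneg)
    show "(\<lambda>r::int. \<rho> ^ nat \<bar>r\<bar> * K * K) summable_on UNIV"
      using \<rho> by (intro summable_on_cmult_left summable_on_int_power_abs)
    show "(\<lambda>n. theta_weight x z r * rpoch x (int n - r) * rpoch x (int n + r)) \<longlonglongrightarrow> theta_weight x z r * (1 / P) * (1 / P)" for r
      using rpoch_tendsto[OF x(1), of "-r"] rpoch_tendsto[OF x(1), of r] unfolding P_def
      by (intro tendsto_intros) auto
  qed
  also have "(\<Sum>\<^sub>\<infinity>r. theta_weight x z r * (1 / P) * (1 / P)) = (\<Sum>\<^sub>\<infinity>r. theta_weight x z r) / P / P"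
    by (simp only: infsum_cmult_left') simp
  finally have lim1: "(\<lambda>n. qpoch z x n * qpoch (x / z) x n / qpoch x x (n + n)) \<longlonglongrightarrow>
      (\<Sum>\<^sub>\<infinity>r. theta_weight x z r) / P / P"
    by (simp only: finite_jacobi_triple_product[OF x z0])
  have "filterlim (\<lambda>n::nat. 2 * n) sequentially sequentially"
    by (simp add: mult_nat_left_at_top)
  hence "(\<lambda>n. qpoch x x (2 * n)) \<longlonglongrightarrow> P"
    unfolding P_def by (rule filterlim_compose[OF qpoch_tendsto_qpoch_inf[OF x(1)]])
  hence lim2: "(\<lambda>n. qpoch z x n * qpoch (x / z) x n / qpoch x x (n + n)) \<longlonglongrightarrow>
      qpoch_inf z x * qpoch_inf (x / z) x / P"
    unfolding mult_2 using P by (intro tendsto_intros qpoch_tendsto_qpoch_inf x)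
  from LIMSEQ_unique[OF lim1 lim2] show ?thesis
    using P by (simp add: P_def field_simps)
qed

lemma infsum_int_eq_nat:
  fixes f :: "int \<Rightarrow> complex"
  assumes "\<And>r. r < 0 \<Longrightarrow> f r = 0"
  shows "(\<Sum>\<^sub>\<infinity>r. f r) = (\<Sum>\<^sub>\<infinity>n. f (int n))"
proof -
  have "r \<in> range int \<longleftrightarrow> r \<ge> 0" for r
    by (metis int_nat_eq of_nat_0_le_iff rangeE rangeI)
  hence "(\<Sum>\<^sub>\<infinity>r. f r) = (\<Sum>\<^sub>\<infinity>r\<in>range int. f r)"
    by (intro infsum_cong_neutral) (auto simp: assms not_le)
  also have "\<dots> = (\<Sum>\<^sub>\<infinity>n. f (int n))"
    by (subst infsum_reindex) (auto simp: o_def)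
  finally show ?thesis .
qed

lemma theta_weight_of_nat: "theta_weight x z (int n) = (- z) ^ n * x ^ (n * (n - 1) div 2)"
proof -
  have "int n * (int n - 1) div 2 = int (n * (n - 1) div 2)"
    by (cases n) (simp_all add: of_nat_div algebra_simps)
  thus ?thesis
    by (simp only: theta_weight_def power_int_of_nat power_minus[of z])
qed

text \<open>The finite triple product at -z with b = 0 and a tending to infinity. The factor
  \<open>rpoch x r\<close> removes the negative indices.\<close>

lemma euler_sum:
  fixes x z :: complex
  assumes x: "norm x < 1" "x \<noteq> 0" and z: "norm z < 1" "z \<noteq> 0"
  shows "(\<Sum>\<^sub>\<infinity>n. z ^ n * x ^ (n * (n - 1) div 2) / qpoch x x n) = qpoch_inf (- z) x"
proof -
  define P where "P = qpoch_inf x x"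
  have P: "P \<noteq> 0" unfolding P_def using x by (intro qpoch_inf_nonzero)
  obtain K where K: "K > 0" "\<And>k. norm (rpoch x k) \<le> K" using rpoch_bounded[OF x(1)] by blast
  let ?w = "theta_weight x (- z)"
  have "(\<lambda>n. bailey_sum x ?w (int n) (int 0)) \<longlonglongrightarrow> (\<Sum>\<^sub>\<infinity>r. ?w r * (1 / P) * rpoch x r)"
    unfolding bailey_sum_def
  proof (rule infsum_tendsto_dominated)
    show "norm (?w r * rpoch x (int n - r) * rpoch x (int 0 + r)) \<le> norm z ^ nat \<bar>r\<bar> * K * K" for r n
    proof (cases "r \<ge> 0")
      case True
      hence "norm (?w r) \<le> norm z ^ nat \<bar>r\<bar>"
        using theta_weight_bound_nonneg[OF x(1) True, of "-z"] by simp
      thus ?thesis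
        unfolding norm_mult using K by (intro mult_mono) (auto intro: less_imp_le mult_nonneg_nonneg)
    qed (use K in \<open>auto simp: rpoch_neg\<close>)
    show "(\<lambda>r::int. norm z ^ nat \<bar>r\<bar> * K * K) summable_on UNIV"
      using z by (intro summable_on_cmult_left summable_on_int_power_abs) auto
    show "(\<lambda>n. ?w r * rpoch x (int n - r) * rpoch x (int 0 + r)) \<longlonglongrightarrow> ?w r * (1 / P) * rpoch x r" for r
      using rpoch_tendsto[OF x(1), of "-r"] unfolding P_def
      by (intro tendsto_intros) auto
  qed
  also have "(\<Sum>\<^sub>\<infinity>r. ?w r * (1 / P) * rpoch x r) = (\<Sum>\<^sub>\<infinity>r. ?w r * rpoch x r * (1 / P))"
    by (simp add: mult_ac)
  also have "\<dots> = (\<Sum>\<^sub>\<infinity>r. ?w r * rpoch x r) / P"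
    by (simp only: infsum_cmult_left') simp
  finally have lim1: "(\<lambda>n. qpoch (- z) x n / qpoch x x n) \<longlonglongrightarrow> (\<Sum>\<^sub>\<infinity>r. ?w r * rpoch x r) / P"
    using finite_jacobi_triple_product[OF x, of "-z" _ 0] z by simp
  have lim2: "(\<lambda>n. qpoch (- z) x n / qpoch x x n) \<longlonglongrightarrow> qpoch_inf (- z) x / P"
    using P unfolding P_def by (intro tendsto_intros qpoch_tendsto_qpoch_inf x)
  from LIMSEQ_unique[OF lim1 lim2] have "(\<Sum>\<^sub>\<infinity>r. ?w r * rpoch x r) = qpoch_inf (- z) x"
    using P by simp
  also have "(\<Sum>\<^sub>\<infinity>r. ?w r * rpoch x r) = (\<Sum>\<^sub>\<infinity>n. ?w (int n) * rpoch x (int n))"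
    by (rule infsum_int_eq_nat) (simp add: rpoch_neg)
  finally show ?thesis by (simp add: theta_weight_of_nat)
qed

section \<open>Bailey's lemma and the Rogers--Selberg identities\<close>

definition durfee_weight :: "complex \<Rightarrow> int \<Rightarrow> int \<Rightarrow> complex" where
  "durfee_weight x s k = x powi (k * (k + s)) * rpoch x (k + s)"

text \<open>Exactly the combination of weights produced by \<open>bailey_sum_pascal\<close>; it
  turns the parameter s into s + 1.\<close>

lemma durfee_weight_rec:
  assumes "norm x < 1" "x \<noteq> 0"
  shows "durfee_weight x s (k + 1) + durfee_weight x s k * x powi k = durfee_weight x (s + 1) k"
proof -
  have "x powi ((k + 1) * (k + 1 + s)) = x powi (k * (k + (s + 1))) * x powi (k + (s + 1))"
    using assms(2) by (simp add: algebra_simps flip: power_int_add)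
  moreover have "x powi (k * (k + s)) * x powi k = x powi (k * (k + (s + 1)))"
    using assms(2) by (simp add: algebra_simps flip: power_int_add)
  moreover have "rpoch x (k + s) = (1 - x powi (k + (s + 1))) * rpoch x (k + (s + 1))"
    using rpoch_rec[OF assms(1), of "k + (s + 1)"] by (simp add: algebra_simps)
  moreover have "k + 1 + s = k + (s + 1)" by simp
  ultimately have 1: "durfee_weight x s (k + 1) =
        x powi (k * (k + (s + 1))) * x powi (k + (s + 1)) * rpoch x (k + (s + 1))"
      and 2: "durfee_weight x s k * x powi k =
        x powi (k * (k + (s + 1))) * ((1 - x powi (k + (s + 1))) * rpoch x (k + (s + 1)))"
    unfolding durfee_weight_def by (metis, metis mult.assoc mult.commute)
  show ?thesis
    unfolding 1 2 by (simp add: durfee_weight_def left_diff_distrib right_diff_distrib)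
qed

lemma bailey_sum_add: "bailey_sum x w a b + bailey_sum x v a b = bailey_sum x (\<lambda>r. w r + v r) a b"
  unfolding bailey_sum_def distrib_right
  by (rule infsum_add[symmetric]) (rule bailey_sum_summable)+

text \<open>The q-Pascal rule: after multiplication by (x; x)_m the sum is one of weights against
  Gaussian binomials. Lowering b gives \<open>?B - ?C\<close>, lowering a gives \<open>?C\<close>
  minus \<open>x powi m\<close> times \<open>?B\<close>, and \<open>?C\<close> cancels on
  addition.\<close>

lemma bailey_sum_pascal:
  assumes x: "norm x < 1" "x \<noteq> 0"
  shows "(1 - x powi m) * bailey_sum x w m 0 = bailey_sum x (\<lambda>k. w (k + 1) + w k * x powi k) (m - 1) 0"
proof -
  let ?B = "bailey_sum x w m 0" and ?C = "bailey_sum x (\<lambda>k. w k * x powi k) m 0"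
  have "bailey_sum x w m (- 1) = ?B - ?C"
    using bailey_sum_rec_right[OF x, of w m 0] by simp
  hence 1: "bailey_sum x (\<lambda>k. w (k + 1)) (m - 1) 0 = ?B - ?C"
    using bailey_sum_shift[of x w m "-1"] by simp
  have 2: "bailey_sum x (\<lambda>k. w k * x powi k) (m - 1) 0 = ?C - x powi m * ?B"
    using bailey_sum_rec_left[OF x, of "\<lambda>k. w k * x powi k" m 0] x(2)
    by (simp add: mult.assoc flip: power_int_add)
  show ?thesis
    unfolding bailey_sum_add[symmetric] 1 2 by (simp add: left_diff_distrib)
qed

text \<open>A case of the q-Vandermonde summation. The Pascal step lowers m and raises s, so s has
  to vary in the induction.\<close>

lemma finite_durfee_sum:
  assumes x: "norm x < 1" "x \<noteq> 0"
  shows "bailey_sum x (durfee_weight x s) (int m) 0 = rpoch x (int m) * rpoch x (int m + s)"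
proof (induction m arbitrary: s)
  case 0
  have "bailey_sum x (durfee_weight x s) 0 0 = (\<Sum>\<^sub>\<infinity>r\<in>{0::int}. rpoch x s)"
    unfolding bailey_sum_def
    by (rule infsum_cong_neutral) (auto simp: rpoch_def durfee_weight_def)
  thus ?case by simp
next
  case (Suc m)
  have nz: "1 - x ^ Suc m \<noteq> 0"
    using one_minus_mult_power_nonzero[OF x(1) x(1), of m] by simp
  have "(1 - x powi int (Suc m)) * bailey_sum x (durfee_weight x s) (int (Suc m)) 0 =
      bailey_sum x (durfee_weight x (s + 1)) (int m) 0"
    unfolding bailey_sum_pascal[OF x] durfee_weight_rec[OF x] by simp
  also have "\<dots> = rpoch x (int m) * rpoch x (int (Suc m) + s)"
    unfolding Suc by (simp add: algebra_simps)
  also have "rpoch x (int m) = (1 - x powi int (Suc m)) * rpoch x (int (Suc m))"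
    using rpoch_rec[OF x(1), of "int (Suc m)"] by simp
  finally show ?case
    using nz unfolding power_int_of_nat mult.assoc mult_cancel_left by blast
qed

text \<open>The limit of \<open>finite_durfee_sum\<close> for m to infinity. For s >= 0 it
  classifies partitions by the largest k by k + s rectangle in their diagram.\<close>

lemma durfee_sum:
  assumes x: "norm x < 1" "x \<noteq> 0"
  shows "(\<Sum>\<^sub>\<infinity>k. x powi (k * (k + s)) * rpoch x k * rpoch x (k + s)) = 1 / qpoch_inf x x"
proof -
  define P where "P = qpoch_inf x x"
  have P: "P \<noteq> 0" unfolding P_def using x by (intro qpoch_inf_nonzero)
  obtain K where K: "K > 0" "\<And>k. norm (rpoch x k) \<le> K" using rpoch_bounded[OF x(1)] by blast
  have bound: "norm (x powi (k * (k + s)) * rpoch x k * rpoch x (k + s)) \<le>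
      norm x powi (- \<bar>s\<bar>) * norm x ^ nat \<bar>k\<bar> * K * K" for k
  proof (cases "k \<ge> 0 \<and> k + s \<ge> 0")
    case True
    \<comment> \<open>The exponent is at least k unless k + s = 0; then it is 0 while k = -s is at
      most |s|.\<close>
    have "k - \<bar>s\<bar> \<le> k * (k + s)"
    proof (cases "k + s = 0")
      case False
      hence "k * 1 \<le> k * (k + s)" using True by (intro mult_left_mono) auto
      thus ?thesis by simp
    qed auto
    hence "norm (x powi (k * (k + s))) \<le> norm x powi (k - \<bar>s\<bar>)"
      using x by (intro norm_power_int_le)
    also have "norm x powi (k - \<bar>s\<bar>) = norm x powi (- \<bar>s\<bar>) * norm x powi k"
      using x by (simp flip: power_int_add)
    also have "norm x powi k = norm x ^ nat \<bar>k\<bar>"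
      using True by (simp add: power_int_def)
    finally show ?thesis
      unfolding norm_mult using K by (intro mult_mono) (auto intro: less_imp_le mult_nonneg_nonneg)
  next
    case False
    thus ?thesis using K by (auto simp: rpoch_neg)
  qed
  have "(\<lambda>m. bailey_sum x (durfee_weight x s) (int m) 0) \<longlonglongrightarrow>
     (\<Sum>\<^sub>\<infinity>k. (1 / P) * (x powi (k * (k + s)) * rpoch x k * rpoch x (k + s)))"
    unfolding bailey_sum_def
  proof (rule infsum_tendsto_dominated)
    fix k :: int
    let ?t = "x powi (k * (k + s)) * rpoch x k * rpoch x (k + s)"
    have eq: "durfee_weight x s k * rpoch x (int n - k) * rpoch x (0 + k) = rpoch x (int n - k) * ?t" for n
      by (simp add: durfee_weight_def mult_ac)
    show "norm (durfee_weight x s k * rpoch x (int n - k) * rpoch x (0 + k)) \<le>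
        K * (norm x powi (- \<bar>s\<bar>) * norm x ^ nat \<bar>k\<bar> * K * K)" for n
      unfolding eq norm_mult[of "rpoch x (int n - k)"] by (intro mult_mono K bound) (use K in auto)
    show "(\<lambda>n. durfee_weight x s k * rpoch x (int n - k) * rpoch x (0 + k)) \<longlonglongrightarrow> (1 / P) * ?t"
      unfolding eq using rpoch_tendsto[OF x(1), of "-k"] by (intro tendsto_intros) (simp add: P_def)
  next
    show "(\<lambda>k::int. K * (norm x powi (- \<bar>s\<bar>) * norm x ^ nat \<bar>k\<bar> * K * K)) summable_on UNIV"
      using x by (intro summable_on_cmult_left summable_on_cmult_right summable_on_int_power_abs) auto
  qed
  hence "(\<lambda>m. rpoch x (int m + 0) * rpoch x (int m + s)) \<longlonglongrightarrow>
     (1 / P) * (\<Sum>\<^sub>\<infinity>k. x powi (k * (k + s)) * rpoch x k * rpoch x (k + s))"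
    by (simp only: finite_durfee_sum[OF x] infsum_cmult_right' add_0_right)
  moreover have "(\<lambda>m. rpoch x (int m + 0) * rpoch x (int m + s)) \<longlonglongrightarrow> (1 / P) * (1 / P)"
    unfolding P_def by (intro tendsto_intros rpoch_tendsto x)
  ultimately have "(1 / P) * (\<Sum>\<^sub>\<infinity>k. x powi (k * (k + s)) * rpoch x k * rpoch x (k + s)) = (1 / P) * (1 / P)"
    by (rule LIMSEQ_unique)
  thus ?thesis using P unfolding P_def mult_cancel_left by simp
qed

section \<open>Bailey's lemma\<close>

lemma summable_on_product_real:
  fixes f :: "'a \<Rightarrow> real" and g :: "'b \<Rightarrow> real"
  assumes "f summable_on A" "g summable_on B" "\<And>x. f x \<ge> 0" "\<And>y. g y \<ge> 0"
  shows "(\<lambda>(x, y). f x * g y) summable_on A \<times> B"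
proof (rule summable_on_SigmaI)
  show "((\<lambda>y. case (x, y) of (x, y) \<Rightarrow> f x * g y) has_sum (f x * infsum g B)) B" for x
    using assms by (auto intro!: has_sum_cmult_right)
  show "(\<lambda>x. f x * infsum g B) summable_on A"
    using assms by (intro summable_on_cmult_left)
qed (use assms in auto)

text \<open>The limiting case with both free parameters sent to infinity. After exchanging the sums,
  n = k + r and n(n + e) = r(r + e) + k(k + 2r + e) turn the inner sum into
  \<open>durfee_sum\<close> with s = 2r + e, whose value does not depend on r.\<close>

theorem bailey_lemma:
  assumes x: "norm x < 1" "x \<noteq> 0" and e: "e = 0 \<or> e = 1"
    and \<rho>: "0 \<le> \<rho>" "\<rho> < 1" and w: "\<And>r. norm (w r) \<le> \<rho> ^ nat \<bar>r\<bar>"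
  shows "(\<Sum>\<^sub>\<infinity>n::nat. x ^ (n * (n + nat e)) * bailey_sum x w (int n) (int n + e)) =
         (\<Sum>\<^sub>\<infinity>r. w r * x powi (r * (r + e))) / qpoch_inf x x"
proof -
  obtain K where K: "K > 0" "\<And>k. norm (rpoch x k) \<le> K" using rpoch_bounded[OF x(1)] by blast
  define t where "t = (\<lambda>n r. x powi (n * (n + e)) * (w r * rpoch x (n - r) * rpoch x (n + e + r)))"
  have bound: "norm (t n r) \<le> (K * K / norm x * norm x ^ nat \<bar>n\<bar>) * \<rho> ^ nat \<bar>r\<bar>" for n r
  proof -
    \<comment> \<open>Summing over all integers n makes the substitution n = k + r a bijection, but
      for e = 1 the exponent also vanishes at n = -1. The loss of 1 accounts for this and causes the
      factor 1/|x| in the majorant.\<close>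
    have "\<bar>n\<bar> - 1 \<le> n * (n + e)"
    proof -
      have "0 \<le> (\<bar>n\<bar> - 1) * (\<bar>n\<bar> - 1)" by simp
      also have "\<dots> = n * n - 2 * \<bar>n\<bar> + 1" by (simp add: algebra_simps)
      finally show ?thesis using e by (auto simp: algebra_simps)
    qed
    hence "norm (x powi (n * (n + e))) \<le> norm x powi (\<bar>n\<bar> - 1)"
      using x by (intro norm_power_int_le)
    also have "\<dots> = norm x ^ nat \<bar>n\<bar> / norm x"
      using x by (simp add: power_int_diff) (simp add: power_int_def)
    finally have "norm (t n r) \<le> (norm x ^ nat \<bar>n\<bar> / norm x) * (\<rho> ^ nat \<bar>r\<bar> * K * K)"
      unfolding t_def norm_mult using K \<rho> w by (intro mult_mono) (auto intro: less_imp_le mult_nonneg_nonneg)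
    thus ?thesis by (simp add: mult_ac)
  qed
  have "(\<lambda>(n::int, r::int). (K * K / norm x * norm x ^ nat \<bar>n\<bar>) * \<rho> ^ nat \<bar>r\<bar>) summable_on UNIV \<times> UNIV"
    using x \<rho> K by (intro summable_on_product_real summable_on_cmult_right summable_on_int_power_abs) auto
  hence "(\<lambda>(n, r). t n r) summable_on UNIV \<times> UNIV"
    by (rule summable_on_dominated) (use bound in auto)
  hence swap: "(\<Sum>\<^sub>\<infinity>n. \<Sum>\<^sub>\<infinity>r. t n r) = (\<Sum>\<^sub>\<infinity>r. \<Sum>\<^sub>\<infinity>n. t n r)"
    by (rule infsum_swap_banach)
  have inner: "(\<Sum>\<^sub>\<infinity>n. t n r) = w r * x powi (r * (r + e)) * (1 / qpoch_inf x x)" for r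
  proof -
    have "(\<Sum>\<^sub>\<infinity>n. t n r) = (\<Sum>\<^sub>\<infinity>k. (w r * x powi (r * (r + e))) *
        (x powi (k * (k + (2 * r + e))) * rpoch x k * rpoch x (k + (2 * r + e))))"
    proof (rule infsum_reindex_bij_witness[of _ "\<lambda>k. k + r" "\<lambda>n. n - r"])
      fix n :: int
      have 1: "x powi (r * (r + e)) * x powi ((n - r) * (n - r + (2 * r + e))) = x powi (n * (n + e))"
        using x(2) by (simp add: algebra_simps flip: power_int_add)
      have 2: "n - r + (2 * r + e) = n + e + r" by simp
      show "w r * x powi (r * (r + e)) * (x powi ((n - r) * (n - r + (2 * r + e))) *
          rpoch x (n - r) * rpoch x (n - r + (2 * r + e))) = t n r"
        unfolding t_def 1[symmetric] 2 by (simp only: mult_ac)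
    qed auto
    thus ?thesis by (simp only: infsum_cmult_right' durfee_sum[OF x])
  qed
  have powi: "x powi (int n * (int n + e)) = x ^ (n * (n + nat e))" for n
  proof -
    have "int n * (int n + e) = int (n * (n + nat e))" using e by auto
    thus ?thesis by (simp only: power_int_of_nat)
  qed
  have "(\<Sum>\<^sub>\<infinity>n. \<Sum>\<^sub>\<infinity>r. t n r) = (\<Sum>\<^sub>\<infinity>n. x powi (n * (n + e)) * bailey_sum x w n (n + e))"
    unfolding t_def bailey_sum_def by (simp only: infsum_cmult_right')
  also have "\<dots> = (\<Sum>\<^sub>\<infinity>n::nat. x powi (int n * (int n + e)) * bailey_sum x w (int n) (int n + e))"
  proof (rule infsum_int_eq_nat)
    fix n :: int assume "n < 0"
    \<comment> \<open>The two indices add up to 2n + e < 0, so at least one of them is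
      negative.\<close>
    hence "rpoch x (n - r) * rpoch x (n + e + r) = 0" for r
      using e by (cases "n - r < 0") (auto simp: rpoch_neg)
    hence "bailey_sum x w n (n + e) = 0"
      unfolding bailey_sum_def by (intro infsum_0) (auto simp: mult.assoc)
    thus "x powi (n * (n + e)) * bailey_sum x w n (n + e) = 0" by simp
  qed
  finally show ?thesis
    using swap unfolding inner powi infsum_cmult_left' by simp
qed

section \<open>The Rogers--Selberg sums\<close>

lemma pent_weight_bound:
  assumes "norm q < 1" "q \<noteq> 0" "d = 0 \<or> d = - 1"
  shows "norm (pent_weight q d r) \<le> norm q ^ nat \<bar>r\<bar>"
proof -
  have "0 \<le> \<bar>r\<bar> * (\<bar>r\<bar> - 1)" by (cases "r = 0") auto
  hence "\<bar>r\<bar> \<le> r * r" by (simp add: algebra_simps)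
  hence "\<bar>r\<bar> \<le> pentagonal r + d * r"
    using two_pentagonal[of r] assms(3) by (auto simp: algebra_simps)
  hence "norm (q powi (pentagonal r + d * r)) \<le> norm q powi \<bar>r\<bar>"
    using assms by (intro norm_power_int_le) auto
  thus ?thesis
    by (simp add: pent_weight_def norm_mult norm_power_int) (simp add: power_int_def)
qed

text \<open>The modulus 7 arises here: the quadratic coefficients 3/2 of the pentagonal exponent and
  2 of the Bailey factor add up to 7/2. Comparing linear terms gives k.\<close>

lemma pent_weight_to_theta_weight:
  assumes "q \<noteq> 0" "int k = 4 + d + 2 * e"
  shows "pent_weight q d r * (q ^ 2) powi (r * (r + e)) = theta_weight (q ^ 7) (q ^ k) r"
proof -
  define h where "h = r * (r - 1) div 2"
  have h: "2 * h = r * (r - 1)" unfolding h_def by (rule dvd_mult_div_cancel) auto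
  have powi: "(q ^ n) powi m = q powi (int n * m)" for n m
    by (simp add: power_int_mult)
  have "pentagonal r + d * r + int 2 * (r * (r + e)) = int k * r + int 7 * h"
    using two_pentagonal[of r] h unfolding assms(2) by (simp add: algebra_simps)
  hence "q powi (pentagonal r + d * r) * q powi (int 2 * (r * (r + e))) = q powi (int k * r) * q powi (int 7 * h)"
    using assms(1) by (simp flip: power_int_add)
  thus ?thesis
    unfolding pent_weight_def theta_weight_def h_def[symmetric] powi by (simp only: mult.assoc)
qed

text \<open>The choices (d, e) = (0, 0), (-1, 1), (0, 1) give k = 4, 5, 6. Since 0 < k < 7, the
  point q^k lies in the annulus required by \<open>jacobi_triple_product\<close> with base
  q^7.\<close>

lemma rogers_selberg_general:
  assumes q: "norm q < 1" "q \<noteq> 0" and d: "d = 0 \<or> d = - 1" and e: "e = 0 \<or> e = 1"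
    and k: "int k = 4 + d + 2 * e" "k \<le> 6"
  shows "(\<Sum>\<^sub>\<infinity>n::nat. (q ^ 2) ^ (n * (n + nat e)) * bailey_sum (q ^ 2) (pent_weight q d) (int n) (int n + e)) =
     qpoch_inf (q ^ k) (q ^ 7) * qpoch_inf (q ^ (7 - k)) (q ^ 7) * qpoch_inf (q ^ 7) (q ^ 7) / qpoch_inf (q ^ 2) (q ^ 2)"
proof -
  have Q: "norm (q ^ 2) < 1" "q ^ 2 \<noteq> 0"
    using q by (auto simp: norm_power power_less_one_iff)
  have k0: "k > 0" using d e k by auto
  have "(\<Sum>\<^sub>\<infinity>n::nat. (q ^ 2) ^ (n * (n + nat e)) * bailey_sum (q ^ 2) (pent_weight q d) (int n) (int n + e)) =
     (\<Sum>\<^sub>\<infinity>r. theta_weight (q ^ 7) (q ^ k) r) / qpoch_inf (q ^ 2) (q ^ 2)"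
    using bailey_lemma[OF Q e _ _ pent_weight_bound[OF q d]] q
    by (simp add: pent_weight_to_theta_weight[OF q(2) k(1)])
  also have "(\<Sum>\<^sub>\<infinity>r. theta_weight (q ^ 7) (q ^ k) r) =
      qpoch_inf (q ^ k) (q ^ 7) * qpoch_inf (q ^ 7 / q ^ k) (q ^ 7) * qpoch_inf (q ^ 7) (q ^ 7)"
    using q k k0 by (intro jacobi_triple_product) (auto simp: norm_power power_less_one_iff intro!: power_strict_decreasing)
  also have "q ^ 7 / q ^ k = q ^ (7 - k)"
    using q k by (simp add: power_diff)
  finally show ?thesis .
qed

theorem rogers_selberg_1:
  fixes q :: complex
  assumes q: "norm q < 1" "q \<noteq> 0"
  shows "(\<Sum>\<^sub>\<infinity>n::nat. q ^ (2 * n * n) / (qpoch (q ^ 2) (q ^ 2) n * qpoch (- q) q (2 * n))) =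
    qpoch_inf (q ^ 4) (q ^ 7) * qpoch_inf (q ^ 3) (q ^ 7) * qpoch_inf (q ^ 7) (q ^ 7) / qpoch_inf (q ^ 2) (q ^ 2)"
  using rogers_selberg_general[OF q, of 0 0 4]
  by (simp add: bailey_pair_A[OF q] mult.assoc flip: power_mult)

theorem rogers_selberg_2:
  fixes q :: complex
  assumes q: "norm q < 1" "q \<noteq> 0"
  shows "(\<Sum>\<^sub>\<infinity>n::nat. q ^ (2 * n * (n + 1)) / (qpoch (q ^ 2) (q ^ 2) n * qpoch (- q) q (2 * n))) =
    qpoch_inf (q ^ 5) (q ^ 7) * qpoch_inf (q ^ 2) (q ^ 7) * qpoch_inf (q ^ 7) (q ^ 7) / qpoch_inf (q ^ 2) (q ^ 2)"
  using rogers_selberg_general[OF q, of "-1" 1 5]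
  by (simp add: bailey_pair_B[OF q] mult.assoc flip: power_mult)

theorem rogers_selberg_3:
  fixes q :: complex
  assumes q: "norm q < 1" "q \<noteq> 0"
  shows "(\<Sum>\<^sub>\<infinity>n::nat. q ^ (2 * n * (n + 1)) / (qpoch (q ^ 2) (q ^ 2) n * qpoch (- q) q (2 * n + 1))) =
    qpoch_inf (q ^ 6) (q ^ 7) * qpoch_inf q (q ^ 7) * qpoch_inf (q ^ 7) (q ^ 7) / qpoch_inf (q ^ 2) (q ^ 2)"
  using rogers_selberg_general[OF q, of 0 1 6]
  by (simp add: bailey_pair_C[OF q] mult.assoc flip: power_mult)

section \<open>Transformation of the double sums\<close>

definition fps_scale :: "complex \<Rightarrow> complex fps \<Rightarrow> complex fps" where
  "fps_scale c f = Abs_fps (\<lambda>n. c ^ n * fps_nth f n)"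

lemma fps_scale_mult: "fps_scale c (f * g) = fps_scale c f * fps_scale c g"
  unfolding fps_scale_def fps_compose_linear[symmetric] by (rule fps_compose_mult_distrib) simp

lemma fps_scale_scale: "fps_scale c (fps_scale d f) = fps_scale (c * d) f"
  by (simp add: fps_scale_def fps_eq_iff power_mult_distrib)

lemma fps_scale_linear: "fps_scale c (1 - fps_const a * fps_X) = 1 - fps_const (c * a) * fps_X"
  by (simp add: fps_scale_def fps_eq_iff fps_X_def)

text \<open>A power series is determined by its constant term and a functional equation
  \<open>f(cz) = W(z) f(z)\<close>, because \<open>c\<^sup>n \<noteq> 1\<close> for \<open>n > 0\<close>.\<close>
lemma fps_scale_unique:
  assumes c: "norm c < 1" and W: "fps_nth W 0 = 1"
    and f: "fps_scale c f = f * W" and g: "fps_scale c g = g * W" and 0: "fps_nth f 0 = fps_nth g 0"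
  shows "f = g"
proof -
  define d where "d = f - g"
  have d: "fps_scale c d = d * W"
    unfolding d_def left_diff_distrib f[symmetric] g[symmetric]
    by (simp add: fps_scale_def fps_eq_iff algebra_simps)
  have "fps_nth d n = 0" for n
  proof (induction n rule: less_induct)
    case (less n)
    show ?case
    proof (cases "n = 0")
      case False
      have "c ^ n * fps_nth d n = fps_nth (d * W) n"
        unfolding d[symmetric] by (simp add: fps_scale_def)
      \<comment> \<open>The lower coefficients of d vanish by induction, so only the term with the
        constant coefficient of W survives.\<close>
      also have "\<dots> = (\<Sum>i\<in>{n}. fps_nth d i * fps_nth W (n - i))"
        unfolding fps_mult_nth by (rule sum.mono_neutral_right) (auto simp: less)
      finally have "(c ^ n - 1) * fps_nth d n = 0"
        using W by (simp add: algebra_simps)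
      moreover have "norm (c ^ n) \<noteq> 1"
        using c False by (simp add: norm_power power_less_one_iff less_imp_neq)
      hence "c ^ n \<noteq> 1" by auto
      ultimately show ?thesis by simp
    qed (use 0 in \<open>simp add: d_def\<close>)
  qed
  thus ?thesis by (simp add: d_def fps_eq_iff)
qed

text \<open>By Euler this is 1/(a z; x)_infinity as a series in z; dilating z by x removes the first
  factor of the product.\<close>

definition euler_fps :: "complex \<Rightarrow> complex \<Rightarrow> complex fps" where
  "euler_fps x a = Abs_fps (\<lambda>n. a ^ n / qpoch x x n)"

lemma euler_fps_scale:
  assumes "norm x < 1"
  shows "fps_scale x (euler_fps x a) = euler_fps x a * (1 - fps_const a * fps_X)"
proof (rule fps_ext)
  fix n
  show "fps_nth (fps_scale x (euler_fps x a)) n = fps_nth (euler_fps x a * (1 - fps_const a * fps_X)) n"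
  proof (cases n)
    case (Suc k)
    have nz: "qpoch x x k \<noteq> 0" "1 - x * x ^ k \<noteq> 0"
      using assms qpoch_nonzero one_minus_mult_power_nonzero by blast+
    have "fps_nth (euler_fps x a * (1 - fps_const a * fps_X)) n = 
        fps_nth (euler_fps x a) (Suc k) - fps_nth (euler_fps x a) k * a"
      unfolding Suc by (simp add: right_diff_distrib flip: mult.assoc)
    also have "\<dots> = x ^ n * (a ^ n / qpoch x x n)"
      using nz by (simp add: Suc euler_fps_def qpoch_Suc divide_simps) (simp add: algebra_simps)
    finally show ?thesis by (simp add: fps_scale_def euler_fps_def)
  qed (simp add: fps_scale_def euler_fps_def)
qed

text \<open>The series of 1/(a z^2; x^2)_infinity. The base is squared because the dilation of z by
  x multiplies z^2 by x^2.\<close>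

definition euler_fps_even :: "complex \<Rightarrow> complex \<Rightarrow> complex fps" where
  "euler_fps_even x a = Abs_fps (\<lambda>n. if even n then a ^ (n div 2) / qpoch (x ^ 2) (x ^ 2) (n div 2) else 0)"

lemma euler_fps_even_scale:
  assumes "norm x < 1"
  shows "fps_scale x (euler_fps_even x a) = euler_fps_even x a * (1 - fps_const a * fps_X ^ 2)"
proof (rule fps_ext)
  fix n
  have x2: "norm (x ^ 2) < 1" using assms by (simp add: norm_power power_less_one_iff)
  have eq: "fps_nth (euler_fps_even x a * (1 - fps_const a * fps_X ^ 2)) n = 
        fps_nth (euler_fps_even x a) n - (if n < 2 then 0 else fps_nth (euler_fps_even x a) (n - 2) * a)" 
    by (simp add: right_diff_distrib fps_X_power_mult_right_nth flip: mult.assoc)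
  show "fps_nth (fps_scale x (euler_fps_even x a)) n = fps_nth (euler_fps_even x a * (1 - fps_const a * fps_X ^ 2)) n"
  proof (cases "even n \<and> n > 0")
    case True
    then obtain k where n: "n = 2 * Suc k"
      by (metis evenE gr0_implies_Suc nat_0_less_mult_iff)
    have nz: "qpoch (x ^ 2) (x ^ 2) k \<noteq> 0" "1 - x ^ 2 * (x ^ 2) ^ k \<noteq> 0"
      using x2 qpoch_nonzero one_minus_mult_power_nonzero by blast+
    have "x ^ n = x ^ 2 * (x ^ 2) ^ k" by (simp add: n power_add power_mult power2_eq_square)
    thus ?thesis unfolding eq
      using nz by (simp add: n euler_fps_even_def fps_scale_def qpoch_Suc divide_simps) (simp add: algebra_simps)
  next
    case False
    thus ?thesis unfolding eq by (auto simp: euler_fps_even_def fps_scale_def)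
  qed
qed

context
  fixes q :: complex
  assumes q: "norm q < 1"
begin

private lemma q2: "norm (q ^ 2) < 1"
  using q by (simp add: norm_power power_less_one_iff)

text \<open>The partner series has base q^2, so the series with base q must be dilated twice, which
  removes two factors.\<close>

private lemma euler_fps_scale_square:
  "fps_scale (q ^ 2) (euler_fps q 1) = euler_fps q 1 * ((1 - fps_X) * (1 - fps_const q * fps_X))"
proof -
  have "fps_scale (q ^ 2) (euler_fps q 1) = fps_scale q (euler_fps q 1 * (1 - fps_const 1 * fps_X))"
    unfolding euler_fps_scale[OF q, symmetric] by (simp add: fps_scale_scale power2_eq_square)
  thus ?thesis
    unfolding fps_scale_mult fps_scale_linear euler_fps_scale[OF q] by (simp add: mult.assoc)
qed

text \<open>Under z -> q^2 z the left side acquires (1 - z)(1 - q z)(1 + z) and the right side (1 -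
  z^2)(1 - q z), which agree; \<open>fps_scale_unique\<close> concludes.\<close>

lemma euler_fps_product_1:
  "euler_fps q 1 * euler_fps (q ^ 2) (- 1) = euler_fps_even (q ^ 2) 1 * euler_fps (q ^ 2) q"
proof (rule fps_scale_unique[OF q2])
  let ?W = "(1 - fps_X ^ 2) * (1 - fps_const q * fps_X)"
  show "fps_nth ?W 0 = 1" by simp
  have *: "fps_const (-1) = - (1 :: complex fps)"
    by (simp flip: fps_const_neg)
  show "fps_scale (q ^ 2) (euler_fps q 1 * euler_fps (q ^ 2) (- 1)) = euler_fps q 1 * euler_fps (q ^ 2) (- 1) * ?W"
    unfolding fps_scale_mult euler_fps_scale_square euler_fps_scale[OF q2] *
    by (simp add: algebra_simps power2_eq_square)
  show "fps_scale (q ^ 2) (euler_fps_even (q ^ 2) 1 * euler_fps (q ^ 2) q) = euler_fps_even (q ^ 2) 1 * euler_fps (q ^ 2) q * ?W"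
    unfolding fps_scale_mult euler_fps_even_scale[OF q2] euler_fps_scale[OF q2]
    by (simp add: algebra_simps)
qed (simp add: euler_fps_def euler_fps_even_def)

text \<open>The same argument with (1 - z)(1 - q z)(1 + q z) = (1 - q^2 z^2)(1 - z).\<close>

lemma euler_fps_product_2:
  "euler_fps q 1 * euler_fps (q ^ 2) (- q) = euler_fps_even (q ^ 2) (q ^ 2) * euler_fps (q ^ 2) 1"
proof (rule fps_scale_unique[OF q2])
  let ?W = "(1 - fps_const (q ^ 2) * fps_X ^ 2) * (1 - fps_X)"
  show "fps_nth ?W 0 = 1" by simp
  have *: "fps_const (- q) = - fps_const q" "fps_const (q ^ 2) = fps_const q ^ 2"
    by (simp_all flip: fps_const_neg fps_const_power)
  have ring: "A * ((1 - X) * (1 - C * X)) * (B * (1 - - C * X)) = A * B * ((1 - C ^ 2 * X ^ 2) * (1 - X))"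
    for A B C X :: "complex fps"
    by (simp add: algebra_simps power2_eq_square)
  show "fps_scale (q ^ 2) (euler_fps q 1 * euler_fps (q ^ 2) (- q)) = euler_fps q 1 * euler_fps (q ^ 2) (- q) * ?W"
    unfolding fps_scale_mult euler_fps_scale_square euler_fps_scale[OF q2] * by (rule ring)
  show "fps_scale (q ^ 2) (euler_fps_even (q ^ 2) (q ^ 2) * euler_fps (q ^ 2) 1) = euler_fps_even (q ^ 2) (q ^ 2) * euler_fps (q ^ 2) 1 * ?W"
    unfolding fps_scale_mult euler_fps_even_scale[OF q2] euler_fps_scale[OF q2]
    by (simp add: algebra_simps)
qed (simp add: euler_fps_def euler_fps_even_def)

end

section \<open>Regrouping the double sums\<close>

lemma infsum_fibers:
  fixes f :: "'a \<Rightarrow> complex" and \<phi> :: "'a \<Rightarrow> 'b"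
  assumes f: "f summable_on UNIV" and fin: "\<And>y. finite {x. \<phi> x = y}"
  shows "(\<Sum>\<^sub>\<infinity>x. f x) = (\<Sum>\<^sub>\<infinity>y. \<Sum>x | \<phi> x = y. f x)"
proof -
  let ?S = "Sigma UNIV (\<lambda>y. {x. \<phi> x = y})"
  have bij: "bij_betw (\<lambda>x. (\<phi> x, x)) UNIV ?S"
    by (rule bij_betwI[of _ _ _ snd]) auto
  have "(\<Sum>\<^sub>\<infinity>x. f x) = (\<Sum>\<^sub>\<infinity>z\<in>?S. f (snd z))"
    using infsum_reindex_bij_betw[OF bij, of "\<lambda>z. f (snd z)"] by simp
  also have "\<dots> = (\<Sum>\<^sub>\<infinity>y. \<Sum>\<^sub>\<infinity>x | \<phi> x = y. f (snd (y, x)))"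
    using summable_on_reindex_bij_betw[OF bij, of "\<lambda>z. f (snd z)"] f
    by (intro infsum_Sigma_banach[symmetric]) simp
  finally show ?thesis using fin by simp
qed

lemma sum_fibers_add:
  "(\<Sum>(m, n) | m + n = N. fps_nth F m * fps_nth G n) = fps_nth (F * G) N"
  unfolding fps_mult_nth
  by (rule sum.reindex_bij_witness[of _ "\<lambda>i. (i, N - i)" fst]) auto

lemma sum_fibers_double_add:
  "(\<Sum>(i, j) | 2 * i + j = N. a ^ i / qpoch (x ^ 2) (x ^ 2) i * fps_nth G j) = fps_nth (euler_fps_even x a * G) N"
proof -
  have "(\<Sum>(i, j) | 2 * i + j = N. a ^ i / qpoch (x ^ 2) (x ^ 2) i * fps_nth G j) =
      (\<Sum>k | k \<le> N \<and> even k. fps_nth (euler_fps_even x a) k * fps_nth G (N - k))"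
    by (rule sum.reindex_bij_witness[of _ "\<lambda>k. (k div 2, N - k)" "\<lambda>(i, j). 2 * i"])
       (auto simp: euler_fps_even_def)
  also have "\<dots> = fps_nth (euler_fps_even x a * G) N"
    unfolding fps_mult_nth by (rule sum.mono_neutral_left) (auto simp: euler_fps_even_def)
  finally show ?thesis .
qed

text \<open>The weight depends only on N, where N = m + n on one side and N = 2i + j on the other.
  Summing along these finite fibres gives w(N) times the N-th coefficients of the two equal
  series.\<close>

lemma double_sum_transform:
  fixes q :: complex and w :: "nat \<Rightarrow> complex"
  assumes q: "norm q < 1" and eq: "euler_fps q 1 * euler_fps (q ^ 2) u = euler_fps_even (q ^ 2) a * euler_fps (q ^ 2) b"
    and w: "\<And>n. norm (w n) \<le> norm q ^ n" and u: "norm u \<le> 1" and a: "norm a \<le> 1" and b: "norm b \<le> 1"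
  shows "((\<lambda>(m, n). w (m + n) * u ^ n / (qpoch q q m * qpoch (q ^ 2) (q ^ 2) n)) has_sum
     (\<Sum>\<^sub>\<infinity>i. \<Sum>\<^sub>\<infinity>j. w (2 * i + j) * a ^ i * b ^ j / (qpoch (q ^ 4) (q ^ 4) i * qpoch (q ^ 2) (q ^ 2) j))) UNIV"
proof -
  have q2: "norm (q ^ 2) < 1" and q4: "norm (q ^ 4) < 1"
    using q by (auto simp: norm_power power_less_one_iff)
  obtain K1 where K1: "K1 > 0" "\<And>k. norm (rpoch q k) \<le> K1" using rpoch_bounded[OF q] by blast
  obtain K2 where K2: "K2 > 0" "\<And>k. norm (rpoch (q ^ 2) k) \<le> K2" using rpoch_bounded[OF q2] by blast
  obtain K4 where K4: "K4 > 0" "\<And>k. norm (rpoch (q ^ 4) k) \<le> K4" using rpoch_bounded[OF q4] by blast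
  have geom: "(\<lambda>(i::nat, j::nat). (C * norm q ^ i) * norm q ^ j) summable_on UNIV" if "C \<ge> 0" for C
  proof -
    have "(\<lambda>n::nat. norm q ^ n) summable_on UNIV"
      using q by (intro summable_nonneg_imp_summable_on) auto
    thus ?thesis
      using summable_on_product_real[of "\<lambda>i. C * norm q ^ i" UNIV "\<lambda>j. norm q ^ j" UNIV] that
      by (simp add: summable_on_cmult_right)
  qed
  let ?f = "\<lambda>(m, n). w (m + n) * u ^ n / (qpoch q q m * qpoch (q ^ 2) (q ^ 2) n)"
  let ?g = "\<lambda>(i, j). w (2 * i + j) * a ^ i * b ^ j / (qpoch (q ^ 4) (q ^ 4) i * qpoch (q ^ 2) (q ^ 2) j)"
  have f: "?f summable_on UNIV"
  proof (rule summable_on_dominated[OF geom[of "K1 * K2"]])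
    fix mn :: "nat \<times> nat" obtain m n where mn: "mn = (m, n)" by (cases mn)
    have "norm (w (m + n) * u ^ n * rpoch q (int m) * rpoch (q ^ 2) (int n)) \<le> norm q ^ (m + n) * 1 * K1 * K2"
      unfolding norm_mult norm_power[of u] using K1 K2 u w
      by (intro mult_mono power_le_one) (auto intro: less_imp_le mult_nonneg_nonneg simp del: rpoch_of_nat)
    thus "norm (?f mn) \<le> (case mn of (i, j) \<Rightarrow> K1 * K2 * norm q ^ i * norm q ^ j)"
      by (simp add: mn power_add mult_ac)
  qed (use K1 K2 in auto)
  have g: "?g summable_on UNIV"
  proof (rule summable_on_dominated[OF geom[of "K4 * K2"]])
    fix ij :: "nat \<times> nat" obtain i j where ij: "ij = (i, j)" by (cases ij)
    have "norm q ^ (2 * i + j) \<le> norm q ^ (i + j)"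
      using q by (intro power_decreasing) auto
    hence "norm (w (2 * i + j)) \<le> norm q ^ (i + j)"
      using w[of "2 * i + j"] by linarith
    hence "norm (w (2 * i + j) * a ^ i * b ^ j * rpoch (q ^ 4) (int i) * rpoch (q ^ 2) (int j)) \<le>
        norm q ^ (i + j) * 1 * 1 * K4 * K2"
      unfolding norm_mult norm_power[of a] norm_power[of b] using K4 K2 a b
      by (intro mult_mono power_le_one) (auto intro: less_imp_le mult_nonneg_nonneg simp del: rpoch_of_nat)
    thus "norm (?g ij) \<le> (case ij of (i, j) \<Rightarrow> K4 * K2 * norm q ^ i * norm q ^ j)"
      by (simp add: ij power_add mult_ac)
  qed (use K4 K2 in auto)
  have fin1: "finite {x. (case x of (m, n) \<Rightarrow> m + n) = N}" for N :: nat
    by (rule finite_subset[of _ "{..N} \<times> {..N}"]) auto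
  have fin2: "finite {x. (case x of (i, j) \<Rightarrow> 2 * i + j) = N}" for N :: nat
    by (rule finite_subset[of _ "{..N} \<times> {..N}"]) auto
  have c1: "(\<Sum>x | (case x of (m, n) \<Rightarrow> m + n) = N. ?f x) = w N * fps_nth (euler_fps q 1 * euler_fps (q ^ 2) u) N" for N
    unfolding sum_fibers_add[symmetric] sum_distrib_left
    by (intro sum.cong) (auto simp: euler_fps_def)
  have c2: "w N * fps_nth (euler_fps q 1 * euler_fps (q ^ 2) u) N =
      (\<Sum>x | (case x of (i, j) \<Rightarrow> 2 * i + j) = N. ?g x)" for N
    unfolding eq sum_fibers_double_add[symmetric] sum_distrib_left
    by (intro sum.cong) (auto simp: euler_fps_def simp flip: power_mult)
  have "infsum ?f UNIV = (\<Sum>\<^sub>\<infinity>N. \<Sum>x | (case x of (m, n) \<Rightarrow> m + n) = N. ?f x)"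
    by (rule infsum_fibers[where \<phi> = "\<lambda>(m, n). m + n", OF f fin1])
  also have "\<dots> = (\<Sum>\<^sub>\<infinity>N. \<Sum>x | (case x of (i, j) \<Rightarrow> 2 * i + j) = N. ?g x)"
    by (simp only: c1 c2)
  also have "\<dots> = infsum ?g UNIV"
    by (rule infsum_fibers[where \<phi> = "\<lambda>(i, j). 2 * i + j", OF g fin2, symmetric])
  also have "\<dots> = (\<Sum>\<^sub>\<infinity>i. \<Sum>\<^sub>\<infinity>j. ?g (i, j))"
    using infsum_Sigma_banach[of ?g UNIV "\<lambda>_. UNIV"] g by simp
  finally show ?thesis
    using has_sum_infsum[OF f] by simp
qed

section \<open>The analytic identities\<close>

lemma qpoch_inf_dissect_7:
  fixes p :: complex
  assumes "norm p < 1"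
  shows "qpoch_inf p p = qpoch_inf p (p ^ 7) * qpoch_inf (p ^ 2) (p ^ 7) * qpoch_inf (p ^ 3) (p ^ 7) *
    qpoch_inf (p ^ 4) (p ^ 7) * qpoch_inf (p ^ 5) (p ^ 7) * qpoch_inf (p ^ 6) (p ^ 7) * qpoch_inf (p ^ 7) (p ^ 7)"
proof -
  have "qpoch_inf p p = (\<Prod>i<7. qpoch_inf (p * p ^ i) (p ^ 7))"
    using assms by (intro qpoch_inf_dissect) auto
  also have "{..<7::nat} = {0, 1, 2, 3, 4, 5, 6}" by auto
  finally show ?thesis
    by (simp add: mult_ac flip: power_Suc power_Suc2 numeral_2_eq_2)
qed

text \<open>Merges the factor (-p; p)_infinity from Euler's sum with the denominator (p^2;
  p^2)_infinity of the Rogers--Selberg sums.\<close>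

lemma qpoch_inf_neg_div:
  fixes p :: complex
  assumes "norm p < 1"
  shows "qpoch_inf (- p) p / qpoch_inf (p ^ 2) (p ^ 2) = 1 / qpoch_inf p p"
proof -
  have "norm (p ^ 2) < 1" using assms by (simp add: norm_power power_less_one_iff)
  hence "qpoch_inf p p \<noteq> 0" "qpoch_inf (p ^ 2) (p ^ 2) \<noteq> 0"
    using assms qpoch_inf_nonzero by blast+
  thus ?thesis using qpoch_inf_neg_mult[OF assms, of p] by (simp add: field_simps)
qed

text \<open>Euler's sum at p^(k+1) gives the tail (-p^(k+1); p)_infinity. Writing it as (-p;
  p)_infinity / (-p; p)_k creates the finite denominator of the Rogers--Selberg sums.\<close>

lemma euler_inner_sum:
  fixes p :: complex
  assumes p: "norm p < 1" "p \<noteq> 0"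
  shows "(\<Sum>\<^sub>\<infinity>j. p ^ e * (p ^ Suc k) ^ j * p ^ (j * (j - 1) div 2) / (c * qpoch p p j)) =
    p ^ e / (c * qpoch (- p) p k) * qpoch_inf (- p) p"
proof -
  have "norm (p ^ Suc k) < 1"
    unfolding norm_power using p by (intro power_Suc_less_one) auto
  hence "(\<Sum>\<^sub>\<infinity>j. (p ^ Suc k) ^ j * p ^ (j * (j - 1) div 2) / qpoch p p j) = qpoch_inf (- (p ^ Suc k)) p"
    using p by (intro euler_sum) auto
  hence "(\<Sum>\<^sub>\<infinity>j. p ^ e / c * ((p ^ Suc k) ^ j * p ^ (j * (j - 1) div 2) / qpoch p p j)) =
      p ^ e / c * qpoch_inf (- (p ^ Suc k)) p"
    by (simp only: infsum_cmult_right')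
  moreover have "qpoch_inf (- p) p = qpoch (- p) p k * qpoch_inf (- (p ^ Suc k)) p"
    using qpoch_inf_split[OF p(1), of "-p" k] by simp
  moreover have "qpoch (- p) p k \<noteq> 0" using p by (intro qpoch_nonzero) auto
  ultimately show ?thesis by (simp add: mult_ac)
qed

lemma two_triangular: "2 * (j * (j - 1) div 2) = j * (j - 1 :: nat)"
  by (rule dvd_mult_div_cancel) (cases j, auto)

text \<open>Splits an exponent quadratic in j into the shape of Euler's sum with base q^2. The term
  \<open>n + j\<close> stands for moving -j out of j(j - 1) without natural subtraction.\<close>

lemma even_exponent:
  fixes q :: complex
  assumes "n + j = 2 * e + 2 * k * j + j * j"
  shows "q ^ n = (q ^ 2) ^ e * ((q ^ 2) ^ k) ^ j * (q ^ 2) ^ (j * (j - 1) div 2)"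
proof -
  have "2 * e + 2 * k * j + 2 * (j * (j - 1) div 2) = n"
    unfolding two_triangular using assms by (cases j) (auto simp: algebra_simps)
  thus ?thesis by (metis power_add power_mult)
qed

lemma norm_power_le_power:
  fixes q :: complex
  assumes "norm q < 1" "n \<le> k"
  shows "norm (q ^ k) \<le> norm q ^ n"
  unfolding norm_power using assms by (intro power_decreasing) auto

context
  fixes q :: complex
  assumes q: "norm q < 1" "q \<noteq> 0"
begin

private lemma p: "norm (q ^ 2) < 1" "q ^ 2 \<noteq> 0"
  using q by (auto simp: norm_power power_less_one_iff)

private lemma nonzero_7: "k > 0 \<Longrightarrow> qpoch_inf ((q ^ 2) ^ k) ((q ^ 2) ^ 7) \<noteq> 0"
  using p(1) by (intro qpoch_inf_nonzero) (auto simp only: norm_power[of "q ^ 2"] power_less_one_iff norm_ge_zero)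

private lemmas to_modulus_7 = qpoch_inf_neg_div[OF p(1)] qpoch_inf_dissect_7[OF p(1)]

lemma analytic_identity_1:
  "((\<lambda>(m, n). q ^ ((m + n) ^ 2) * (- 1) ^ n / (qpoch q q m * qpoch (q ^ 2) (q ^ 2) n)) has_sum
     (1 / qpoch_inf_list [q ^ 2, q ^ 4, q ^ 10, q ^ 12] (q ^ 14))) UNIV"
proof -
  let ?p = "q ^ 2"
  have "((\<lambda>(m, n). q ^ ((m + n) ^ 2) * (- 1) ^ n / (qpoch q q m * qpoch (q ^ 2) (q ^ 2) n)) has_sum
    (\<Sum>\<^sub>\<infinity>i. \<Sum>\<^sub>\<infinity>j. q ^ ((2 * i + j) ^ 2) * 1 ^ i * q ^ j / (qpoch (q ^ 4) (q ^ 4) i * qpoch (q ^ 2) (q ^ 2) j))) UNIV"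
    using q by (intro double_sum_transform euler_fps_product_1 norm_power_le_power) (auto simp: power2_eq_square)
  also have "(\<lambda>i j. q ^ ((2 * i + j) ^ 2) * 1 ^ i * q ^ j / (qpoch (q ^ 4) (q ^ 4) i * qpoch ?p ?p j)) =
    (\<lambda>i j. ?p ^ (2 * i * i) * (?p ^ Suc (2 * i)) ^ j * ?p ^ (j * (j - 1) div 2) / (qpoch (?p ^ 2) (?p ^ 2) i * qpoch ?p ?p j))"
  proof (intro ext)
    fix i j :: nat
    have "q ^ ((2 * i + j) ^ 2 + j) = ?p ^ (2 * i * i) * (?p ^ Suc (2 * i)) ^ j * ?p ^ (j * (j - 1) div 2)"
      by (rule even_exponent) (simp add: power2_eq_square algebra_simps)
    thus "q ^ ((2 * i + j) ^ 2) * 1 ^ i * q ^ j / (qpoch (q ^ 4) (q ^ 4) i * qpoch ?p ?p j) =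
      ?p ^ (2 * i * i) * (?p ^ Suc (2 * i)) ^ j * ?p ^ (j * (j - 1) div 2) / (qpoch (?p ^ 2) (?p ^ 2) i * qpoch ?p ?p j)"
      by (simp only: power_add power_one mult_1_right) simp
  qed
  also have "(\<Sum>\<^sub>\<infinity>i. \<Sum>\<^sub>\<infinity>j. ?p ^ (2 * i * i) * (?p ^ Suc (2 * i)) ^ j * ?p ^ (j * (j - 1) div 2) / (qpoch (?p ^ 2) (?p ^ 2) i * qpoch ?p ?p j)) =
     (\<Sum>\<^sub>\<infinity>i. ?p ^ (2 * i * i) / (qpoch (?p ^ 2) (?p ^ 2) i * qpoch (- ?p) ?p (2 * i))) * qpoch_inf (- ?p) ?p"
    by (simp only: euler_inner_sum[OF p] infsum_cmult_left')
  also have "\<dots> = qpoch_inf (?p ^ 4) (?p ^ 7) * qpoch_inf (?p ^ 3) (?p ^ 7) * qpoch_inf (?p ^ 7) (?p ^ 7) *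
      (qpoch_inf (- ?p) ?p / qpoch_inf (?p ^ 2) (?p ^ 2))"
    by (simp only: rogers_selberg_1[OF p] times_divide_eq_left times_divide_eq_right)
  \<comment> \<open>The quotient is 1/(p; p)_infinity, split modulo 7. The classes 3, 4, 7 cancel
    against the numerator, leaving 1, 2, 5, 6.\<close>
  also have "\<dots> = 1 / (qpoch_inf ?p (?p ^ 7) * (qpoch_inf (?p ^ 2) (?p ^ 7) * (qpoch_inf (?p ^ 5) (?p ^ 7) * qpoch_inf (?p ^ 6) (?p ^ 7))))"
    unfolding to_modulus_7 using nonzero_7[of 3] nonzero_7[of 4] nonzero_7[of 7] by (simp only: divide_simps) simp
  also have "\<dots> = 1 / qpoch_inf_list [q ^ 2, q ^ 4, q ^ 10, q ^ 12] (q ^ 14)"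
    by (simp add: qpoch_inf_list_def flip: power_mult)
  finally show ?thesis .
qed

text \<open>The extra exponent n is absorbed into \<open>(- q) ^ n\<close>, so the weight again
  depends only on m + n and \<open>euler_fps_product_2\<close> applies.\<close>

lemma analytic_identity_2:
  "((\<lambda>(m, n). q ^ ((m + n) ^ 2 + (m + n)) * (- q) ^ n / (qpoch q q m * qpoch (q ^ 2) (q ^ 2) n)) has_sum
     (1 / qpoch_inf_list [q ^ 2, q ^ 6, q ^ 8, q ^ 12] (q ^ 14))) UNIV"
proof -
  let ?p = "q ^ 2"
  have "((\<lambda>(m, n). q ^ ((m + n) ^ 2 + (m + n)) * (- q) ^ n / (qpoch q q m * qpoch (q ^ 2) (q ^ 2) n)) has_sum
    (\<Sum>\<^sub>\<infinity>i. \<Sum>\<^sub>\<infinity>j. q ^ ((2 * i + j) ^ 2 + (2 * i + j)) * ?p ^ i * 1 ^ j / (qpoch (q ^ 4) (q ^ 4) i * qpoch (q ^ 2) (q ^ 2) j))) UNIV"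
    using q p by (intro double_sum_transform euler_fps_product_2 norm_power_le_power) (auto simp: power2_eq_square)
  also have "(\<lambda>i j. q ^ ((2 * i + j) ^ 2 + (2 * i + j)) * ?p ^ i * 1 ^ j / (qpoch (q ^ 4) (q ^ 4) i * qpoch ?p ?p j)) =
    (\<lambda>i j. ?p ^ (2 * i * (i + 1)) * (?p ^ Suc (2 * i)) ^ j * ?p ^ (j * (j - 1) div 2) / (qpoch (?p ^ 2) (?p ^ 2) i * qpoch ?p ?p j))"
  proof (intro ext)
    fix i j :: nat
    have "q ^ ((2 * i + j) ^ 2 + (2 * i + j) + 2 * i) = ?p ^ (2 * i * (i + 1)) * (?p ^ Suc (2 * i)) ^ j * ?p ^ (j * (j - 1) div 2)"
      by (rule even_exponent) (simp add: power2_eq_square algebra_simps)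
    moreover have "q ^ ((2 * i + j) ^ 2 + (2 * i + j) + 2 * i) = q ^ ((2 * i + j) ^ 2 + (2 * i + j)) * ?p ^ i"
      by (simp only: power_add power_mult)
    ultimately show "q ^ ((2 * i + j) ^ 2 + (2 * i + j)) * ?p ^ i * 1 ^ j / (qpoch (q ^ 4) (q ^ 4) i * qpoch ?p ?p j) =
      ?p ^ (2 * i * (i + 1)) * (?p ^ Suc (2 * i)) ^ j * ?p ^ (j * (j - 1) div 2) / (qpoch (?p ^ 2) (?p ^ 2) i * qpoch ?p ?p j)"
      by (simp only: power_one mult_1_right) simp
  qed
  also have "(\<Sum>\<^sub>\<infinity>i. \<Sum>\<^sub>\<infinity>j. ?p ^ (2 * i * (i + 1)) * (?p ^ Suc (2 * i)) ^ j * ?p ^ (j * (j - 1) div 2) / (qpoch (?p ^ 2) (?p ^ 2) i * qpoch ?p ?p j)) =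
     (\<Sum>\<^sub>\<infinity>i. ?p ^ (2 * i * (i + 1)) / (qpoch (?p ^ 2) (?p ^ 2) i * qpoch (- ?p) ?p (2 * i))) * qpoch_inf (- ?p) ?p"
    by (simp only: euler_inner_sum[OF p] infsum_cmult_left')
  also have "\<dots> = qpoch_inf (?p ^ 5) (?p ^ 7) * qpoch_inf (?p ^ 2) (?p ^ 7) * qpoch_inf (?p ^ 7) (?p ^ 7) *
      (qpoch_inf (- ?p) ?p / qpoch_inf (?p ^ 2) (?p ^ 2))"
    by (simp only: rogers_selberg_2[OF p] times_divide_eq_left times_divide_eq_right)
  also have "\<dots> = 1 / (qpoch_inf ?p (?p ^ 7) * (qpoch_inf (?p ^ 3) (?p ^ 7) * (qpoch_inf (?p ^ 4) (?p ^ 7) * qpoch_inf (?p ^ 6) (?p ^ 7))))"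
    unfolding to_modulus_7 using nonzero_7[of 2] nonzero_7[of 5] nonzero_7[of 7] by (simp only: divide_simps) simp
  also have "\<dots> = 1 / qpoch_inf_list [q ^ 2, q ^ 6, q ^ 8, q ^ 12] (q ^ 14)"
    by (simp add: qpoch_inf_list_def flip: power_mult)
  finally show ?thesis .
qed

lemma analytic_identity_3:
  "((\<lambda>(m, n). q ^ ((m + n) ^ 2 + 2 * (m + n)) * (- 1) ^ n / (qpoch q q m * qpoch (q ^ 2) (q ^ 2) n)) has_sum
     (1 / qpoch_inf_list [q ^ 4, q ^ 6, q ^ 8, q ^ 10] (q ^ 14))) UNIV"
proof -
  let ?p = "q ^ 2"
  have "((\<lambda>(m, n). q ^ ((m + n) ^ 2 + 2 * (m + n)) * (- 1) ^ n / (qpoch q q m * qpoch (q ^ 2) (q ^ 2) n)) has_sum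
    (\<Sum>\<^sub>\<infinity>i. \<Sum>\<^sub>\<infinity>j. q ^ ((2 * i + j) ^ 2 + 2 * (2 * i + j)) * 1 ^ i * q ^ j / (qpoch (q ^ 4) (q ^ 4) i * qpoch (q ^ 2) (q ^ 2) j))) UNIV"
    using q by (intro double_sum_transform euler_fps_product_1 norm_power_le_power) (auto simp: power2_eq_square)
  also have "(\<lambda>i j. q ^ ((2 * i + j) ^ 2 + 2 * (2 * i + j)) * 1 ^ i * q ^ j / (qpoch (q ^ 4) (q ^ 4) i * qpoch ?p ?p j)) =
    (\<lambda>i j. ?p ^ (2 * i * (i + 1)) * (?p ^ Suc (2 * i + 1)) ^ j * ?p ^ (j * (j - 1) div 2) / (qpoch (?p ^ 2) (?p ^ 2) i * qpoch ?p ?p j))"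
  proof (intro ext)
    fix i j :: nat
    \<comment> \<open>The linear term 2(m + n) raises Euler's argument to p^(2i+2); this yields the
      odd index 2i + 1 of the third Rogers--Selberg sum.\<close>
    have "q ^ ((2 * i + j) ^ 2 + 2 * (2 * i + j) + j) = ?p ^ (2 * i * (i + 1)) * (?p ^ Suc (2 * i + 1)) ^ j * ?p ^ (j * (j - 1) div 2)"
      by (rule even_exponent) (simp add: power2_eq_square algebra_simps)
    moreover have "q ^ ((2 * i + j) ^ 2 + 2 * (2 * i + j) + j) = q ^ ((2 * i + j) ^ 2 + 2 * (2 * i + j)) * q ^ j"
      by (simp only: power_add)
    ultimately show "q ^ ((2 * i + j) ^ 2 + 2 * (2 * i + j)) * 1 ^ i * q ^ j / (qpoch (q ^ 4) (q ^ 4) i * qpoch ?p ?p j) =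
      ?p ^ (2 * i * (i + 1)) * (?p ^ Suc (2 * i + 1)) ^ j * ?p ^ (j * (j - 1) div 2) / (qpoch (?p ^ 2) (?p ^ 2) i * qpoch ?p ?p j)"
      by (simp only: power_one mult_1_right) simp
  qed
  also have "(\<Sum>\<^sub>\<infinity>i. \<Sum>\<^sub>\<infinity>j. ?p ^ (2 * i * (i + 1)) * (?p ^ Suc (2 * i + 1)) ^ j * ?p ^ (j * (j - 1) div 2) / (qpoch (?p ^ 2) (?p ^ 2) i * qpoch ?p ?p j)) =
     (\<Sum>\<^sub>\<infinity>i. ?p ^ (2 * i * (i + 1)) / (qpoch (?p ^ 2) (?p ^ 2) i * qpoch (- ?p) ?p (2 * i + 1))) * qpoch_inf (- ?p) ?p"
    by (simp only: euler_inner_sum[OF p] infsum_cmult_left')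
  also have "\<dots> = qpoch_inf (?p ^ 6) (?p ^ 7) * qpoch_inf ?p (?p ^ 7) * qpoch_inf (?p ^ 7) (?p ^ 7) *
      (qpoch_inf (- ?p) ?p / qpoch_inf (?p ^ 2) (?p ^ 2))"
    by (simp only: rogers_selberg_3[OF p] times_divide_eq_left times_divide_eq_right)
  also have "\<dots> = 1 / (qpoch_inf (?p ^ 2) (?p ^ 7) * (qpoch_inf (?p ^ 3) (?p ^ 7) * (qpoch_inf (?p ^ 4) (?p ^ 7) * qpoch_inf (?p ^ 5) (?p ^ 7))))"
    unfolding to_modulus_7 using nonzero_7[of 1] nonzero_7[of 6] nonzero_7[of 7] by (simp only: divide_simps) simp
  also have "\<dots> = 1 / qpoch_inf_list [q ^ 4, q ^ 6, q ^ 8, q ^ 10] (q ^ 14)"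
    by (simp add: qpoch_inf_list_def flip: power_mult)
  finally show ?thesis .
qed

end

section \<open>Transfer to formal power series\<close>

lemma qpoch_fps_X_nth_stable:
  assumes "k > 0" "l > 0" "n \<le> m"
  shows "fps_nth (qpoch (fps_X ^ k) (fps_X ^ l) m :: complex fps) n = fps_nth (qpoch (fps_X ^ k) (fps_X ^ l) n) n"
  using assms(3)
proof (induction m rule: dec_induct)
  case (step m)
  have "m \<le> l * m" using assms by simp
  \<comment> \<open>The next factor only affects coefficients from index k + l m on.\<close>
  hence "n < k + l * m" using step assms by linarith
  moreover have "qpoch (fps_X ^ k) (fps_X ^ l) (Suc m) =
      qpoch (fps_X ^ k) (fps_X ^ l) m - qpoch (fps_X ^ k) (fps_X ^ l) m * (fps_X ^ (k + l * m) :: complex fps)"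
    by (simp add: qpoch_Suc right_diff_distrib power_add power_mult)
  ultimately show ?case
    using step by (simp add: fps_X_power_mult_right_nth)
qed simp

lemma qpoch_fps_X_nth_0: "k > 0 \<Longrightarrow> fps_nth (qpoch (fps_X ^ k) q n :: complex fps) 0 = 1"
  by (induction n) (simp_all add: qpoch_Suc)

lemma qpoch_fps_X_tendsto:
  assumes "k > 0" "l > 0"
  shows "(\<lambda>n. qpoch (fps_X ^ k) (fps_X ^ l) n :: complex fps) \<longlonglongrightarrow> qpoch_inf (fps_X ^ k) (fps_X ^ l)"
    and "fps_nth (qpoch_inf (fps_X ^ k) (fps_X ^ l) :: complex fps) 0 = 1"
proof -
  define L where "L = Abs_fps (\<lambda>n. fps_nth (qpoch (fps_X ^ k) (fps_X ^ l) n :: complex fps) n)"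
  have L0: "fps_nth L 0 = 1" by (simp add: L_def)
  have lim: "(\<lambda>n. qpoch (fps_X ^ k) (fps_X ^ l) n) \<longlonglongrightarrow> L"
  proof (rule tendsto_fpsI)
    fix n
    show "\<forall>\<^sub>F m in sequentially. fps_nth (qpoch (fps_X ^ k) (fps_X ^ l) m) n = fps_nth L n"
      using eventually_ge_at_top[of n]
      by eventually_elim (unfold L_def fps_nth_Abs_fps, rule qpoch_fps_X_nth_stable[OF assms])
  qed
  \<comment> \<open>A raw product needs a nonzero limit, which the constant term 1
    guarantees.\<close>
  hence "raw_has_prod (\<lambda>j. 1 - fps_X ^ k * (fps_X ^ l) ^ j) 0 L"
    using L0 unfolding raw_has_prod_def qpoch_conv_prod_lessThan
    by (auto simp: LIMSEQ_lessThan_iff_atMost)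
  hence "L = qpoch_inf (fps_X ^ k) (fps_X ^ l)"
    unfolding qpoch_inf_def by (intro has_prod_unique) (auto simp: has_prod_def)
  thus "(\<lambda>n. qpoch (fps_X ^ k) (fps_X ^ l) n :: complex fps) \<longlonglongrightarrow> qpoch_inf (fps_X ^ k) (fps_X ^ l)"
    and "fps_nth (qpoch_inf (fps_X ^ k) (fps_X ^ l) :: complex fps) 0 = 1"
    using lim L0 by auto
qed

lemma qpoch_has_fps_expansion:
  "(\<lambda>q :: complex. qpoch (q ^ k) (q ^ l) n) has_fps_expansion qpoch (fps_X ^ k) (fps_X ^ l) n"
  unfolding qpoch_def power_mult[symmetric] power_add[symmetric] by (intro fps_expansion_intros)

lemma qpoch_holomorphic: "(\<lambda>q. qpoch (q ^ k) (q ^ l) n) holomorphic_on A"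
  unfolding qpoch_def by (intro holomorphic_intros)

lemma qpoch_uniform_limit:
  assumes "k > 0" "l > 0"
  shows "uniform_limit (cball 0 (1/2)) (\<lambda>n q. qpoch (q ^ k) (q ^ l) n) (\<lambda>q :: complex. qpoch_inf (q ^ k) (q ^ l)) sequentially"
proof -
  have "uniformly_convergent_on (cball 0 (1/2)) (\<lambda>n q :: complex. \<Prod>j<n. 1 - q ^ k * (q ^ l) ^ j)"
  proof (rule uniformly_convergent_on_prod')
    show "uniformly_convergent_on (cball 0 (1/2)) (\<lambda>n q :: complex. \<Sum>j<n. norm (1 - q ^ k * (q ^ l) ^ j - 1))"
    proof (rule Weierstrass_m_test'[where M = "\<lambda>j. (1/2) ^ j"])
      fix j and q :: complex assume q: "q \<in> cball 0 (1/2)"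
      have "norm q ^ (k + l * j) \<le> norm q ^ j"
        using q assms by (intro power_decreasing) (auto intro: trans_le_add2)
      also have "\<dots> \<le> (1/2) ^ j"
        using q by (intro power_mono) auto
      finally show "norm (norm (1 - q ^ k * (q ^ l) ^ j - 1)) \<le> (1/2) ^ j"
        by (simp add: norm_mult norm_power power_add power_mult)
    qed auto
  qed (auto intro!: continuous_intros)
  then obtain L where L: "uniform_limit (cball 0 (1/2)) (\<lambda>n q :: complex. qpoch (q ^ k) (q ^ l) n) L sequentially"
    unfolding qpoch_conv_prod_lessThan uniformly_convergent_on_def by blast
  have "L q = qpoch_inf (q ^ k) (q ^ l)" if "q \<in> cball 0 (1/2)" for q
  proof (rule LIMSEQ_unique)
    show "(\<lambda>n. qpoch (q ^ k) (q ^ l) n) \<longlonglongrightarrow> L q"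
      using tendsto_uniform_limitI[OF L that] .
    have "norm (q ^ l) < 1" using that assms by (simp add: norm_power power_less_one_iff)
    thus "(\<lambda>n. qpoch (q ^ k) (q ^ l) n) \<longlonglongrightarrow> qpoch_inf (q ^ k) (q ^ l)"
      by (rule qpoch_tendsto_qpoch_inf)
  qed
  hence "uniform_limit (cball 0 (1/2)) (\<lambda>n q. qpoch (q ^ k) (q ^ l) n) L sequentially \<longleftrightarrow> ?thesis"
    by (intro uniform_limit_cong') auto
  with L show ?thesis by blast
qed

text \<open>Locally uniform limits of holomorphic functions pass to Taylor coefficients. The partial
  products therefore have the same limit expansion analytically and formally.\<close>

lemma qpoch_inf_has_fps_expansion:
  assumes "k > 0" "l > 0"
  shows "(\<lambda>q :: complex. qpoch_inf (q ^ k) (q ^ l)) has_fps_expansion qpoch_inf (fps_X ^ k) (fps_X ^ l)"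
proof -
  let ?f = "\<lambda>q :: complex. qpoch_inf (q ^ k) (q ^ l)"
  have "?f holomorphic_on ball 0 (1/2)"
  proof (rule holomorphic_uniform_limit[OF _ qpoch_uniform_limit[OF assms]])
    show "\<forall>\<^sub>F n in sequentially. continuous_on (cball 0 (1/2)) (\<lambda>q :: complex. qpoch (q ^ k) (q ^ l) n) \<and>
        (\<lambda>q. qpoch (q ^ k) (q ^ l) n) holomorphic_on ball 0 (1/2)"
      by (intro always_eventually allI conjI qpoch_holomorphic holomorphic_on_imp_continuous_on)
  qed auto
  hence exp: "?f has_fps_expansion fps_expansion ?f 0"
    by (rule has_fps_expansion_fps_expansion[rotated 2]) auto
  have "fps_expansion ?f 0 = qpoch_inf (fps_X ^ k) (fps_X ^ l)"
  proof (rule uniform_limit_imp_fps_expansion_eq)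
    show "(\<lambda>n. qpoch (fps_X ^ k) (fps_X ^ l) n :: complex fps) \<longlonglongrightarrow> qpoch_inf (fps_X ^ k) (fps_X ^ l)"
      using assms by (rule qpoch_fps_X_tendsto)
    show "uniform_limit (ball 0 (1/2)) (\<lambda>n q. qpoch (q ^ k) (q ^ l) n) ?f sequentially"
      by (rule uniform_limit_on_subset[OF qpoch_uniform_limit[OF assms]]) auto
  qed (use exp in \<open>auto intro!: always_eventually qpoch_has_fps_expansion qpoch_holomorphic\<close>)
  with exp show ?thesis by simp
qed

lemma qpoch_inf_list_has_fps_expansion:
  assumes "\<forall>k\<in>set ks. k > 0" "l > 0"
  shows "(\<lambda>q :: complex. qpoch_inf_list (map (\<lambda>k. q ^ k) ks) (q ^ l)) has_fps_expansion
           qpoch_inf_list (map (\<lambda>k. fps_X ^ k) ks) (fps_X ^ l)"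
    and "fps_nth (qpoch_inf_list (map (\<lambda>k. fps_X ^ k) ks) (fps_X ^ l) :: complex fps) 0 = 1"
  using assms
  by (induction ks)
     (auto simp: qpoch_inf_list_def qpoch_fps_X_tendsto(2) intro!: has_fps_expansion_mult qpoch_inf_has_fps_expansion)

text \<open>On the disc of radius 1/2 each factor satisfies |1 - x^(j+1)| >= 1 - 2^-(j+1), with
  equality at x = 1/2. This makes the bound on the reciprocals uniform in x.\<close>

lemma norm_qpoch_ge:
  fixes x :: complex
  assumes "norm x \<le> 1/2"
  shows "norm (qpoch (1/2) (1/2) n :: complex) \<le> norm (qpoch x x n)"
  unfolding qpoch_conv_prod_lessThan prod_norm[symmetric]
proof (rule prod_mono, safe)
  fix j
  have "norm (1 - 1/2 * (1/2) ^ j :: complex) = 1 - (1/2) ^ Suc j"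
  proof -
    have "(1 - 1/2 * (1/2) ^ j :: complex) = complex_of_real (1 - (1/2) ^ Suc j)" by simp
    moreover have "0 \<le> 1 - (1/2 :: real) ^ Suc j" using power_le_one[of "1/2 :: real" "Suc j"] by simp
    ultimately show ?thesis by (metis abs_of_nonneg norm_of_real)
  qed
  also have "\<dots> \<le> 1 - norm x ^ Suc j"
    using assms by (intro diff_left_mono power_mono) auto
  also have "\<dots> \<le> norm (1 - x * x ^ j)"
    using norm_triangle_ineq2[of 1 "x * x ^ j"] by (simp add: norm_mult norm_power)
  finally show "norm (1 - 1/2 * (1/2) ^ j :: complex) \<le> norm (1 - x * x ^ j)" .
qed simp

text \<open>The finite partial sums converge coefficientwise to a formal series S and uniformly near
  0 to the analytic right-hand side, so S is the expansion of that function.\<close>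

lemma has_sum_fps_transfer:
  fixes e :: "nat \<Rightarrow> nat \<Rightarrow> nat"
  assumes e: "\<And>m n. m + n \<le> e m n" and ks: "\<forall>k\<in>set ks. k > 0" "l > 0"
    and analytic: "\<And>q :: complex. norm q < 1 \<Longrightarrow>
      ((\<lambda>(m, n). (-1) ^ n * q ^ e m n / (qpoch q q m * qpoch (q ^ 2) (q ^ 2) n)) has_sum
        (1 / qpoch_inf_list (map (\<lambda>k. q ^ k) ks) (q ^ l))) UNIV"
  shows "((\<lambda>(m, n). (-1) ^ n * fps_X ^ e m n / (qpoch fps_X fps_X m * qpoch (fps_X ^ 2) (fps_X ^ 2) n)) has_sum
        (1 / qpoch_inf_list (map (\<lambda>k. fps_X ^ k) ks) (fps_X ^ l) :: complex fps)) UNIV"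
proof -
  let ?f = "\<lambda>(m, n) q :: complex. (-1) ^ n * q ^ e m n / (qpoch q q m * qpoch (q ^ 2) (q ^ 2) n)"
  let ?F = "\<lambda>(m, n). (-1) ^ n * fps_X ^ e m n / (qpoch fps_X fps_X m * qpoch (fps_X ^ 2) (fps_X ^ 2) n) :: complex fps"
  define D :: "nat \<Rightarrow> nat \<Rightarrow> complex fps" where "D m n = qpoch fps_X fps_X m * qpoch (fps_X ^ 2) (fps_X ^ 2) n" for m n
  have D0: "fps_nth (D m n) 0 = 1" for m n
    using qpoch_fps_X_nth_0[of 1] qpoch_fps_X_nth_0[of 2] by (simp add: D_def)
  have F0: "fps_nth (?F (m, n)) i = 0" if "i < m + n" for m n i
  proof -
    have "?F (m, n) = (-1) ^ n * inverse (D m n) * fps_X ^ e m n"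
      using D0[of m n] by (simp add: D_def[symmetric] fps_divide_unit mult_ac)
    thus ?thesis using that e[of m n] by (simp add: fps_X_power_mult_right_nth)
  qed
  \<comment> \<open>The bound \<open>m + n \<le> e m n\<close> leaves finitely many terms
    contributing to each coefficient.\<close>
  define S where "S = Abs_fps (\<lambda>i. \<Sum>x | x \<in> UNIV \<and> fps_nth (?F x) i \<noteq> 0. fps_nth (?F x) i)"
  have S: "(?F has_sum S) UNIV"
  proof (rule has_sum_fpsI)
    fix i
    have "{x \<in> UNIV. fps_nth (?F x) i \<noteq> 0} \<subseteq> {..i} \<times> {..i}"
      using F0[of i] by (force simp: not_less[symmetric] intro: ccontr)
    thus "finite {x \<in> UNIV. fps_nth (?F x) i \<noteq> 0}"
      by (rule finite_subset) auto
  qed (simp add: S_def)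
  \<comment> \<open>One constant bounds both reciprocals, because q^2 also has norm at most
    1/2.\<close>
  obtain K where K: "K > 0" "\<And>k. norm (rpoch (1/2) k) \<le> K"
    using rpoch_bounded[of "1/2"] by (auto simp: norm_divide)
  have K': "norm (1 / qpoch x x m) \<le> K" if "norm x \<le> 1/2" for x :: complex and m
  proof -
    have "qpoch (1/2) (1/2) m \<noteq> (0 :: complex)" by (rule qpoch_nonzero) (auto simp: norm_divide)
    hence "norm (1 / qpoch x x m) \<le> norm (rpoch (1/2) (int m))"
      using norm_qpoch_ge[OF that, of m] by (auto simp: norm_divide intro!: divide_left_mono mult_pos_pos)
    thus ?thesis using K(2)[of "int m"] by linarith
  qed
  have nz: "qpoch q q m \<noteq> 0" "qpoch (q ^ 2) (q ^ 2) m \<noteq> 0" if "norm q < 1/2" for q :: complex and m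
    using that by (simp_all add: qpoch_nonzero norm_power power_less_one_iff)
  have "1 / qpoch_inf_list (map (\<lambda>k. fps_X ^ k) ks) (fps_X ^ l) = S"
  proof (rule uniform_limit_imp_fps_expansion_eq)
    show "(sum ?F \<longlongrightarrow> S) (finite_subsets_at_top UNIV)"
      using S by (simp add: has_sum_def)
    show "uniform_limit (ball 0 (1/2)) (\<lambda>X q. \<Sum>x\<in>X. ?f x q)
        (\<lambda>q. 1 / qpoch_inf_list (map (\<lambda>k. q ^ k) ks) (q ^ l)) (finite_subsets_at_top UNIV)"
    proof (rule Weierstrass_m_test_general'[where M = "\<lambda>(m, n). K * K * (1/2) ^ m * (1/2) ^ n"])
      fix mn :: "nat \<times> nat" and q :: complex
      assume q: "q \<in> ball 0 (1/2)"
      obtain m n where mn: "mn = (m, n)" by (cases mn)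
      have "norm q ^ 2 \<le> norm q ^ 1" using q by (intro power_decreasing) auto
      hence q2: "norm (q ^ 2) \<le> 1/2" using q by (simp add: norm_power)
      have "norm q ^ e m n \<le> norm q ^ (m + n)" using q e by (intro power_decreasing) auto
      also have "\<dots> \<le> (1/2) ^ (m + n)" using q by (intro power_mono) auto
      finally have "norm q ^ e m n * norm (1 / qpoch q q m) * norm (1 / qpoch (q ^ 2) (q ^ 2) n) \<le> (1/2) ^ (m + n) * K * K"
        using q q2 K by (intro mult_mono K') (auto intro: less_imp_le)
      thus "norm (?f mn q) \<le> (case mn of (m, n) \<Rightarrow> K * K * (1/2) ^ m * (1/2) ^ n)"
        by (simp add: mn norm_mult norm_divide norm_power power_add mult_ac)
    next
      show "((\<lambda>x. ?f x q) has_sum 1 / qpoch_inf_list (map (\<lambda>k. q ^ k) ks) (q ^ l)) UNIV" if "q \<in> ball 0 (1/2)" for q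
        using analytic[of q] that by (simp add: case_prod_unfold)
      have "(\<lambda>n::nat. (1/2 :: real) ^ n) summable_on UNIV"
        by (intro summable_nonneg_imp_summable_on) auto
      thus "(\<lambda>(m, n). K * K * (1/2) ^ m * (1/2) ^ n) summable_on (UNIV :: (nat \<times> nat) set)"
        using summable_on_product_real[of "\<lambda>m. K * K * (1/2) ^ m" "UNIV :: nat set" "\<lambda>n. (1/2) ^ n" "UNIV :: nat set"] K
        by (simp add: summable_on_cmult_right)
    qed
    show "(\<lambda>q :: complex. 1 / qpoch_inf_list (map (\<lambda>k. q ^ k) ks) (q ^ l)) has_fps_expansion
        1 / qpoch_inf_list (map (\<lambda>k. fps_X ^ k) ks) (fps_X ^ l)"
      by (rule has_fps_expansion_divide'[OF has_fps_expansion_1 qpoch_inf_list_has_fps_expansion(1)[OF ks]])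
         (simp add: qpoch_inf_list_has_fps_expansion(2)[OF ks])
    have "?f x has_fps_expansion ?F x" for x
    proof (cases x)
      case (Pair m n)
      have "(\<lambda>q :: complex. (-1) ^ n) has_fps_expansion (-1) ^ n"
        using has_fps_expansion_const[of "(-1) ^ n :: complex"]
        by (simp add: fps_const_power[symmetric] fps_const_neg[symmetric] del: fps_const_power fps_const_neg)
      thus ?thesis
        unfolding Pair prod.case using D0[of m n] qpoch_has_fps_expansion[of 1 1 m] qpoch_has_fps_expansion[of 2 2 n]
        by (intro has_fps_expansion_divide' has_fps_expansion_mult has_fps_expansion_fps_X_power) (auto simp: D_def)
    qed
    thus "\<forall>\<^sub>F X in finite_subsets_at_top UNIV. (\<lambda>q. \<Sum>x\<in>X. ?f x q) has_fps_expansion sum ?F X"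
      by (intro always_eventually allI has_fps_expansion_sum)
    have "?f x holomorphic_on ball 0 (1/2)" for x
      using qpoch_holomorphic[of 1 1] qpoch_holomorphic[of 2 2] nz
      by (cases x) (auto intro!: holomorphic_intros)
    thus "\<forall>\<^sub>F X in finite_subsets_at_top UNIV. (\<lambda>q. \<Sum>x\<in>X. ?f x q) holomorphic_on ball 0 (1/2)"
      by (intro always_eventually allI holomorphic_on_sum)
  qed auto
  with S show ?thesis by simp
qed

section \<open>Exponents and the value q = 0\<close>

lemma two_choose_2: "2 * (m + 1 choose 2) = m * (m + 1)"
  unfolding choose_two by (simp add: mult.commute)

text \<open>Before the subtractions the exponent is (m + n)^2 + m + n, so natural subtraction never
  truncates.\<close>

lemma exponent_1: "2 * (m + 1 choose 2) + 2 * (n + 1 choose 2) + 2 * m * n - m - n = (m + n) ^ 2"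
  unfolding two_choose_2 by (simp add: power2_eq_square algebra_simps)

lemma exponent_2: "2 * (m + 1 choose 2) + 2 * (n + 1 choose 2) + 2 * m * n + n = (m + n) ^ 2 + (m + n) + n"
  unfolding two_choose_2 by (simp add: power2_eq_square algebra_simps)

lemma exponent_3: "2 * (m + 1 choose 2) + 2 * (n + 1 choose 2) + 2 * m * n + m + n = (m + n) ^ 2 + 2 * (m + n)"
  unfolding two_choose_2 by (simp add: power2_eq_square algebra_simps)

text \<open>The analytic identities were derived with integer powers of a nonzero q. At q = 0 only
  the term m = n = 0 survives, and it equals 1 because \<open>e 0 0 = 0\<close>.\<close>

lemma has_sum_at_0:
  fixes e :: "nat \<Rightarrow> nat \<Rightarrow> nat"
  assumes e: "\<And>m n. m + n \<le> e m n" "e 0 0 = 0" and ks: "\<forall>k\<in>set ks. k > 0" "l > 0"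
  shows "((\<lambda>(m, n). (-1) ^ n * 0 ^ e m n / (qpoch 0 0 m * qpoch (0 ^ 2) (0 ^ 2) n)) has_sum
    (1 / qpoch_inf_list (map (\<lambda>k. 0 ^ k) ks) (0 ^ l) :: complex)) UNIV"
proof -
  have "qpoch_inf_list (map (\<lambda>k. 0 ^ k) ks) (0 ^ l) = (1 :: complex)"
    using ks(1) by (induction ks) (auto simp: qpoch_inf_list_def qpoch_inf_def power_0_left)
  moreover have "((\<lambda>(m, n). (-1) ^ n * 0 ^ e m n / (qpoch 0 0 m * qpoch (0 ^ 2) (0 ^ 2) n)) has_sum (1 :: complex)) UNIV
      \<longleftrightarrow> ((\<lambda>_. 1) has_sum (1 :: complex)) {(0 :: nat, 0 :: nat)}"
  proof (rule has_sum_cong_neutral)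
    fix x :: "nat \<times> nat" assume x: "x \<in> UNIV - {(0, 0)}"
    obtain m n where mn: "x = (m, n)" by (cases x)
    have "e m n > 0" using e(1)[of m n] x mn by (cases "m + n") auto
    thus "(case x of (m, n) \<Rightarrow> (-1) ^ n * 0 ^ e m n / (qpoch 0 0 m * qpoch (0 ^ 2) (0 ^ 2) n)) = (0 :: complex)"
      by (simp add: mn)
  qed (auto simp: e)
  ultimately show ?thesis by (simp add: has_sum_finiteI)
qed

lemma analytic_identities:
  fixes q :: complex
  assumes q: "norm q < 1"
  shows "((\<lambda>(m, n). (-1) ^ n * q ^ ((m + n) ^ 2) / (qpoch q q m * qpoch (q ^ 2) (q ^ 2) n)) has_sum
           (1 / qpoch_inf_list (map (\<lambda>k. q ^ k) [2, 4, 10, 12]) (q ^ 14))) UNIV"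
    and "((\<lambda>(m, n). (-1) ^ n * q ^ ((m + n) ^ 2 + (m + n) + n) / (qpoch q q m * qpoch (q ^ 2) (q ^ 2) n)) has_sum
           (1 / qpoch_inf_list (map (\<lambda>k. q ^ k) [2, 6, 8, 12]) (q ^ 14))) UNIV"
    and "((\<lambda>(m, n). (-1) ^ n * q ^ ((m + n) ^ 2 + 2 * (m + n)) / (qpoch q q m * qpoch (q ^ 2) (q ^ 2) n)) has_sum
           (1 / qpoch_inf_list (map (\<lambda>k. q ^ k) [4, 6, 8, 10]) (q ^ 14))) UNIV"
proof -
  have le: "m + n \<le> (m + n) ^ 2" for m n :: nat by (simp add: power2_eq_square)
  have le': "m + n \<le> (m + n) ^ 2 + (m + n) + n" "m + n \<le> (m + n) ^ 2 + 2 * (m + n)" for m n :: nat by auto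
  have "(-1) ^ n * q ^ ((m + n) ^ 2 + (m + n) + n) = q ^ ((m + n) ^ 2 + (m + n)) * (- q) ^ n" for m n :: nat
    by (simp add: power_add power_minus[of q])
  note eq = this
  show "((\<lambda>(m, n). (-1) ^ n * q ^ ((m + n) ^ 2) / (qpoch q q m * qpoch (q ^ 2) (q ^ 2) n)) has_sum
           (1 / qpoch_inf_list (map (\<lambda>k. q ^ k) [2, 4, 10, 12]) (q ^ 14))) UNIV"
    using analytic_identity_1[OF q] has_sum_at_0[OF le, of "[2, 4, 10, 12]" 14]
    by (cases "q = 0") (simp_all add: mult.commute)
  show "((\<lambda>(m, n). (-1) ^ n * q ^ ((m + n) ^ 2 + (m + n) + n) / (qpoch q q m * qpoch (q ^ 2) (q ^ 2) n)) has_sum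
           (1 / qpoch_inf_list (map (\<lambda>k. q ^ k) [2, 6, 8, 12]) (q ^ 14))) UNIV"
    using analytic_identity_2[OF q] has_sum_at_0[OF le'(1), of "[2, 6, 8, 12]" 14]
    by (cases "q = 0") (simp_all only: eq, simp_all)
  show "((\<lambda>(m, n). (-1) ^ n * q ^ ((m + n) ^ 2 + 2 * (m + n)) / (qpoch q q m * qpoch (q ^ 2) (q ^ 2) n)) has_sum
           (1 / qpoch_inf_list (map (\<lambda>k. q ^ k) [4, 6, 8, 10]) (q ^ 14))) UNIV"
    using analytic_identity_3[OF q] has_sum_at_0[OF le'(2), of "[4, 6, 8, 10]" 14]
    by (cases "q = 0") (simp_all add: mult.commute)
qed

lemma formal_identities:
  "((\<lambda>(m, n). (-1) ^ n * fps_X ^ ((m + n) ^ 2) / (qpoch fps_X fps_X m * qpoch (fps_X ^ 2) (fps_X ^ 2) n)) has_sum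
     (1 / qpoch_inf_list (map (\<lambda>k. fps_X ^ k) [2, 4, 10, 12]) (fps_X ^ 14) :: complex fps)) UNIV"
  "((\<lambda>(m, n). (-1) ^ n * fps_X ^ ((m + n) ^ 2 + (m + n) + n) / (qpoch fps_X fps_X m * qpoch (fps_X ^ 2) (fps_X ^ 2) n)) has_sum
     (1 / qpoch_inf_list (map (\<lambda>k. fps_X ^ k) [2, 6, 8, 12]) (fps_X ^ 14) :: complex fps)) UNIV"
  "((\<lambda>(m, n). (-1) ^ n * fps_X ^ ((m + n) ^ 2 + 2 * (m + n)) / (qpoch fps_X fps_X m * qpoch (fps_X ^ 2) (fps_X ^ 2) n)) has_sum
     (1 / qpoch_inf_list (map (\<lambda>k. fps_X ^ k) [4, 6, 8, 10]) (fps_X ^ 14) :: complex fps)) UNIV"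
  by (rule has_sum_fps_transfer; (rule analytic_identities)?; simp add: power2_eq_square)+

theorem theorem3:
  shows "(let q = (fps_X :: complex fps) in
    ((\<lambda>(m, n). (-1) ^ n * q ^ (2 * (m + 1 choose 2) + 2 * (n + 1 choose 2) + 2 * m * n - m - n)
         / (qpoch q q m * qpoch (q ^ 2) (q ^ 2) n))
       has_sum (1 / qpoch_inf_list [q ^ 2, q ^ 4, q ^ 10, q ^ 12] (q ^ 14))) (UNIV :: (nat \<times> nat) set) \<and>
    ((\<lambda>(m, n). (-1) ^ n * q ^ (2 * (m + 1 choose 2) + 2 * (n + 1 choose 2) + 2 * m * n + n)
         / (qpoch q q m * qpoch (q ^ 2) (q ^ 2) n))
       has_sum (1 / qpoch_inf_list [q ^ 2, q ^ 6, q ^ 8, q ^ 12] (q ^ 14))) (UNIV :: (nat \<times> nat) set) \<and>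
    ((\<lambda>(m, n). (-1) ^ n * q ^ (2 * (m + 1 choose 2) + 2 * (n + 1 choose 2) + 2 * m * n + m + n)
         / (qpoch q q m * qpoch (q ^ 2) (q ^ 2) n))
       has_sum (1 / qpoch_inf_list [q ^ 4, q ^ 6, q ^ 8, q ^ 10] (q ^ 14))) (UNIV :: (nat \<times> nat) set)) \<and>
   (\<forall>q :: complex. norm q < 1 \<longrightarrow>
    ((\<lambda>(m, n). (-1) ^ n * q ^ (2 * (m + 1 choose 2) + 2 * (n + 1 choose 2) + 2 * m * n - m - n)
         / (qpoch q q m * qpoch (q ^ 2) (q ^ 2) n))
       has_sum (1 / qpoch_inf_list [q ^ 2, q ^ 4, q ^ 10, q ^ 12] (q ^ 14))) (UNIV :: (nat \<times> nat) set) \<and>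
    ((\<lambda>(m, n). (-1) ^ n * q ^ (2 * (m + 1 choose 2) + 2 * (n + 1 choose 2) + 2 * m * n + n)
         / (qpoch q q m * qpoch (q ^ 2) (q ^ 2) n))
       has_sum (1 / qpoch_inf_list [q ^ 2, q ^ 6, q ^ 8, q ^ 12] (q ^ 14))) (UNIV :: (nat \<times> nat) set) \<and>
    ((\<lambda>(m, n). (-1) ^ n * q ^ (2 * (m + 1 choose 2) + 2 * (n + 1 choose 2) + 2 * m * n + m + n)
         / (qpoch q q m * qpoch (q ^ 2) (q ^ 2) n))
       has_sum (1 / qpoch_inf_list [q ^ 4, q ^ 6, q ^ 8, q ^ 10] (q ^ 14))) (UNIV :: (nat \<times> nat) set))"
  unfolding Let_def exponent_1 exponent_2 exponent_3
  using formal_identities analytic_identities by simp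

end
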